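(* Let $n>5$ be an integer. For every connected graph $G$ with $n$ vertices and no pendant vertex, we have $$\mathrm{N}(G)\geq \mathrm{N}(D_n)= \frac{(n-1)(n+6)}{2},$$ and $D_n$ is, up to isomorphism, the only connected graph with $n$ vertices and no pendant vertex attaining this minimum, i.e. satisfying $\mathrm{N}(G)=\frac{(n-1)(n+6)}{2}$.
   Context: All graphs are finite and simple. A pendant vertex is a vertex of degree $1$. $\mathrm{N}(G)$ denotes the number of connected induced subgraphs of $G$, i.e. the number of nonempty subsets of $V(G)$ inducing a connected graph. $D_n$ (the double tadpole graph $D_n(3;3)$) is the graph on $n$ vertices constructed from three pairwise vertex disjoint graphs, namely two triangles $C_3$, $C_3'$ and a path $P_{n-4}$ on $n-4$ vertices, by identifying a vertex of $C_3$ with one leaf of $P_{n-4}$ and a vertex of $C_3'$ with the other leaf of $P_{n-4}$. *)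

theory Defs
  imports Complex_Main "Graph_Theory.Graph_Theory"
begin

text \<open>
  A finite simple graph is a digraph in the locale \<^locale>\<open>graph\<close>: finite, loop-free, without
  parallel arcs and symmetric, so that an undirected edge is a pair of opposite arcs. Hence the
  degree of a vertex is its out-degree (which equals its in-degree).
\<close>

definition pendant :: "('a, 'b) pre_digraph \<Rightarrow> 'a \<Rightarrow> bool" where
  "pendant G v \<longleftrightarrow> v \<in> verts G \<and> out_degree G v = 1"

definition num_connected_induced :: "('a, 'b) pre_digraph \<Rightarrow> nat" where
  "num_connected_induced G =
     card {S. S \<subseteq> verts G \<and> S \<noteq> {} \<and> Digraph_Component.connected (G \<restriction> S)}"

definition graph_of :: "'a set \<Rightarrow> ('a \<times> 'a) set \<Rightarrow> ('a, 'a \<times> 'a) pre_digraph" where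
  "graph_of V E = with_proj \<lparr> pverts = V, parcs = E \<union> E\<inverse> \<rparr>"

definition path_graph :: "nat \<Rightarrow> (nat, nat \<times> nat) pre_digraph" where
  "path_graph k = graph_of {..<k} {(i, Suc i) | i. Suc i < k}"

definition triangle_graph :: "'a \<Rightarrow> 'a \<Rightarrow> 'a \<Rightarrow> ('a, 'a \<times> 'a) pre_digraph" where
  "triangle_graph a b c = graph_of {a, b, c} {(a, b), (b, c), (c, a)}"

text \<open>
  The double tadpole graph \<open>D\<^sub>n = D\<^sub>n(3;3)\<close>, meant for \<open>n > 5\<close>. The path on \<open>n - 4\<close> vertices has
  the leaves \<open>0\<close> and \<open>n - 5\<close>. Identification of vertices is realised by naming: the first triangle
  meets the path exactly in \<open>0\<close>, the second one exactly in \<open>n - 5\<close>, and the two triangles are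
  disjoint.
\<close>

definition double_tadpole :: "nat \<Rightarrow> (nat, nat \<times> nat) pre_digraph" where
  "double_tadpole n =
     Digraph_Component.union
       (Digraph_Component.union (path_graph (n - 4)) (triangle_graph 0 (n - 4) (n - 3)))
       (triangle_graph (n - 5) (n - 2) (n - 1))"

end

theory Submission
  imports Defs
begin

text \<open>
  Let \<open>N(G)\<close> be the number of connected vertex sets of \<open>G\<close> and let \<open>f(n)\<close> be the claimed minimum. The
  lower bound is an induction over graphs of minimum degree two that removes or contracts one edge
  at a time.

  Contracting an edge \<open>uv\<close> turns the connected sets that contain both or none of \<open>u\<close> and \<open>v\<close> into the
  connected sets of the contracted graph. Hence \<open>N(G)\<close> exceeds \<open>N(G/uv)\<close> exactly by the number of
  connected sets that contain one of the two ends, and if \<open>uv\<close> lies in no triangle, then \<open>G/uv\<close>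
  again has minimum degree two. Let \<open>A\<close> be the component of \<open>u\<close> in \<open>G - v\<close> and \<open>B\<close> the component of \<open>v\<close>
  in \<open>G - u\<close>. The sets to be counted are the connected sets through the root \<open>u\<close> in \<open>A\<close> and those
  through the root \<open>v\<close> in \<open>B\<close>.
  If \<open>uv\<close> is a bridge, then \<open>A\<close> and \<open>B\<close> partition the vertices. A rooted graph on \<open>a\<close> vertices, all
  but the root of degree at least two, has at least \<open>a + 1\<close> connected sets through the root, with
  equality only for a path from the root that ends in a triangle
  (\<open>card_rooted_sets_tadpole\<close>). This gives the increment \<open>n + 2 = f(n) - f(n - 1)\<close>, and equality
  forces two tadpoles joined by the bridge, which is \<open>D\<^sub>n\<close>.
  If \<open>uv\<close> is no bridge, then \<open>A\<close> and \<open>B\<close> overlap in at least two vertices, and the increment is at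
  least \<open>2n - 2\<close> (\<open>card_rooted_sets_cycle\<close>), which is more than \<open>n + 2\<close> once \<open>n > 4\<close>.

  There remain the graphs in which every edge lies in a triangle. If an edge joins two vertices of
  degree at least three, it can be deleted: the graph stays connected and loses at least the
  connected set formed by the edge itself. If there is no such edge, all triangles share one
  vertex, which dominates the graph, and \<open>N(G)\<close> is exponential in \<open>n\<close>.

  The induction has to start below \<open>n = 6\<close>, where the cycle beats the double tadpole. There the
  bound is \<open>N(C\<^sub>n) = n\<^sup>2 - n + 1\<close>; it increases by \<open>2n - 2\<close> in each step, which is just what an edge
  on a cycle provides. The one place where the smaller bound does not suffice is a bridge for
  \<open>n = 6\<close>: contracting it gives two triangles with a common vertex, and this graph has \<open>22\<close>
  connected sets, one more than \<open>C\<^sub>5\<close>.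

  For the value of \<open>N(D\<^sub>n)\<close> the vertices are arranged as a path with two chords. A connected set is
  then an interval from which at most the second and the last but one vertex are missing. This
  gives \<open>N(D\<^sub>n) \<le> f(n)\<close>; the other inequality is the general lower bound.
\<close>

section \<open>Connected vertex sets\<close>

text \<open>
  Connectedness is phrased by cuts: an edge leaves every nonempty proper part. Gluing, contracting
  and deleting then only require one suitable edge for each cut, and no walks.
\<close>

definition connected_on :: "('a \<Rightarrow> 'a \<Rightarrow> bool) \<Rightarrow> 'a set \<Rightarrow> bool" where
  "connected_on E S \<longleftrightarrow> S \<noteq> {} \<and> (\<forall>P. P \<subset> S \<longrightarrow> P \<noteq> {} \<longrightarrow> (\<exists>x\<in>P. \<exists>y\<in>S - P. E x y))"

definition connected_sets :: "('a \<Rightarrow> 'a \<Rightarrow> bool) \<Rightarrow> 'a set \<Rightarrow> 'a set set" where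
  "connected_sets E V = {S. S \<subseteq> V \<and> connected_on E S}"

definition rooted_sets :: "('a \<Rightarrow> 'a \<Rightarrow> bool) \<Rightarrow> 'a set \<Rightarrow> 'a \<Rightarrow> 'a set set" where
  "rooted_sets E A u = {S. S \<subseteq> A \<and> u \<in> S \<and> connected_on E S}"

text \<open>
  Degree at least two inside \<open>V\<close>. With witnesses in place of a cardinality the condition survives
  every change of the graph that keeps the two witnesses apart and adjacent.
\<close>

definition two_nbrs :: "('a \<Rightarrow> 'a \<Rightarrow> bool) \<Rightarrow> 'a set \<Rightarrow> 'a \<Rightarrow> bool" where
  "two_nbrs E V x \<longleftrightarrow> (\<exists>y\<in>V. \<exists>z\<in>V. y \<noteq> z \<and> E x y \<and> E x z)"

lemma connected_onE:
  assumes "connected_on E S" "P \<subseteq> S" "P \<noteq> S" "P \<noteq> {}"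
  obtains x y where "x \<in> P" "y \<in> S" "y \<notin> P" "E x y"
  using assms unfolding connected_on_def by (metis DiffE psubsetI)

lemma connected_onI:
  assumes "S \<noteq> {}"
    and "\<And>P. P \<subseteq> S \<Longrightarrow> P \<noteq> S \<Longrightarrow> P \<noteq> {} \<Longrightarrow> \<exists>x\<in>P. \<exists>y\<in>S - P. E x y"
  shows "connected_on E S"
  using assms unfolding connected_on_def by blast

lemma connected_on_nonempty: "connected_on E S \<Longrightarrow> S \<noteq> {}"
  by (simp add: connected_on_def)

lemma connected_on_singleton [simp]: "connected_on E {u}"
  by (auto simp: connected_on_def)

lemma connected_on_mono:
  assumes "connected_on E S" and "\<And>x y. x \<in> S \<Longrightarrow> y \<in> S \<Longrightarrow> E x y \<Longrightarrow> E' x y"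
  shows "connected_on E' S"
proof (rule connected_onI)
  show "S \<noteq> {}" using assms(1) by (rule connected_on_nonempty)
  fix P assume "P \<subseteq> S" "P \<noteq> S" "P \<noteq> {}"
  then obtain x y where "x \<in> P" "y \<in> S" "y \<notin> P" "E x y"
    using connected_onE[OF assms(1)] by blast
  then show "\<exists>x\<in>P. \<exists>y\<in>S - P. E' x y" using assms(2) \<open>P \<subseteq> S\<close> by blast
qed

lemma connected_on_Union:
  assumes "F \<noteq> {}" and "\<And>S. S \<in> F \<Longrightarrow> connected_on E S \<and> u \<in> S"
  shows "connected_on E (\<Union>F)"
proof (rule connected_onI)
  show "\<Union>F \<noteq> {}" using assms by blast
  fix P assume P: "P \<subseteq> \<Union>F" "P \<noteq> \<Union>F" "P \<noteq> {}"
  have "\<exists>S\<in>F. P \<inter> S \<noteq> {} \<and> P \<inter> S \<noteq> S"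
  proof (cases "u \<in> P")
    case True
    obtain w S where "w \<in> S" "S \<in> F" "w \<notin> P" using P by blast
    then show ?thesis using True assms(2) by blast
  next
    case False
    obtain w S where "w \<in> S" "S \<in> F" "w \<in> P" using P by blast
    then show ?thesis using False assms(2) by blast
  qed
  then obtain S where S: "S \<in> F" "P \<inter> S \<noteq> {}" "P \<inter> S \<noteq> S" by blast
  obtain x y where "x \<in> P \<inter> S" "y \<in> S" "y \<notin> P \<inter> S" "E x y"
    using S assms(2) connected_onE[of E S "P \<inter> S"] by blast
  then show "\<exists>x\<in>P. \<exists>y\<in>\<Union>F - P. E x y" using S(1) by blast
qed

lemma connected_on_Un:
  assumes "connected_on E S" "connected_on E T" "u \<in> S" "u \<in> T"
  shows "connected_on E (S \<union> T)"
  using connected_on_Union[of "{S, T}" E u] assms by auto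

lemma connected_on_pair:
  assumes "symp E" "E s b"
  shows "connected_on E {s, b}"
proof (rule connected_onI)
  fix P assume P: "P \<subseteq> {s, b}" "P \<noteq> {s, b}" "P \<noteq> {}"
  then have "P = {s} \<and> b \<noteq> s \<or> P = {b} \<and> b \<noteq> s" by auto
  then show "\<exists>x\<in>P. \<exists>y\<in>{s, b} - P. E x y" using assms by (auto dest: sympD)
qed simp

lemma connected_on_insert:
  assumes "symp E" "connected_on E S" "s \<in> S" "E s b"
  shows "connected_on E (insert b S)"
proof -
  have "connected_on E (S \<union> {s, b})"
    using assms connected_on_pair[of E s b] by (intro connected_on_Un[of E S "{s, b}" s]) auto
  moreover have "S \<union> {s, b} = insert b S" using assms(3) by auto
  ultimately show ?thesis by simp
qed

text \<open>
  A connected proper subset of \<open>A\<close> can be enlarged by one vertex at a time, so every size between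
  that of \<open>S\<close> and that of \<open>A\<close> is attained. All lower bounds for rooted graphs start from such a chain.
\<close>

lemma connected_sets_between:
  assumes "symp E" "finite A" "connected_on E A" "connected_on E S" "S \<subseteq> A"
  shows "card A + 1 \<le> card S + card {T. S \<subseteq> T \<and> T \<subseteq> A \<and> connected_on E T}"
  using assms(4,5)
proof (induction "card A - card S" arbitrary: S)
  case 0
  then have "S = A" using assms(2) by (simp add: card_seteq)
  then have "{T. S \<subseteq> T \<and> T \<subseteq> A \<and> connected_on E T} = {A}" using assms(3) by auto
  then show ?case using \<open>S = A\<close> by simp
next
  case (Suc k)
  then have "S \<noteq> A" "S \<noteq> {}" using connected_on_nonempty by auto
  then obtain s b where sb: "s \<in> S" "b \<in> A" "b \<notin> S" "E s b"
    using connected_onE[OF assms(3) Suc.prems(2)] by blast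
  have fS: "finite S" using Suc.prems(2) assms(2) by (rule finite_subset)
  let ?F = "\<lambda>S. {T. S \<subseteq> T \<and> T \<subseteq> A \<and> connected_on E T}"
  have fin: "finite (?F S)" using assms(2) by (auto intro: finite_subset[of _ "Pow A"])
  have "card A + 1 \<le> card (insert b S) + card (?F (insert b S))"
    using Suc sb fS connected_on_insert[OF assms(1) Suc.prems(1) sb(1,4)]
    by (intro Suc.hyps(1)) auto
  moreover have "insert S (?F (insert b S)) \<subseteq> ?F S" using Suc.prems by auto
  then have "card (insert S (?F (insert b S))) \<le> card (?F S)" by (rule card_mono[OF fin])
  moreover have "finite (?F (insert b S))" using assms(2) by (auto intro: finite_subset[of _ "Pow A"])
  then have "card (insert S (?F (insert b S))) = Suc (card (?F (insert b S)))" using sb(3) by auto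
  ultimately show ?case using sb(3) fS by simp
qed

lemma finite_connected_sets: "finite V \<Longrightarrow> finite (connected_sets E V)"
  by (auto simp: connected_sets_def intro: finite_subset[of _ "Pow V"])

lemma finite_rooted_sets: "finite A \<Longrightarrow> finite (rooted_sets E A u)"
  by (auto simp: rooted_sets_def intro: finite_subset[of _ "Pow A"])

lemma card_rooted_sets_ge:
  assumes "symp E" "finite A" "connected_on E A" "u \<in> A"
  shows "card A \<le> card (rooted_sets E A u)"
proof -
  have "{T. {u} \<subseteq> T \<and> T \<subseteq> A \<and> connected_on E T} = rooted_sets E A u"
    by (auto simp: rooted_sets_def)
  then show ?thesis using connected_sets_between[OF assms(1-3), of "{u}"] assms(4) by simp
qed

text \<open>
  Two graphs that share only the root contribute independently: any two connected sets through
  the root have a connected union, and the union determines both of them.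
\<close>

lemma card_rooted_sets_glued:
  assumes "symp E" "finite X" "finite Y" "X \<inter> Y = {}" "u \<notin> X" "u \<notin> Y"
    and X: "connected_on E (insert u X)" and Y: "connected_on E (insert u Y)"
  shows "(card X + 1) * (card Y + 1) \<le> card (rooted_sets E (insert u (X \<union> Y)) u)"
proof -
  let ?RX = "rooted_sets E (insert u X) u" and ?RY = "rooted_sets E (insert u Y) u"
  have "inj_on (\<lambda>(S, T). S \<union> T) (?RX \<times> ?RY)"
  proof (rule inj_onI, clarsimp)
    fix S T S' T'
    assume "S \<in> ?RX" "T \<in> ?RY" "S' \<in> ?RX" "T' \<in> ?RY" and eq: "S \<union> T = S' \<union> T'"
    then have "u \<in> S" "u \<in> S'" "u \<in> T" "u \<in> T'"
      "S \<subseteq> insert u X" "S' \<subseteq> insert u X" "T \<subseteq> insert u Y" "T' \<subseteq> insert u Y"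
      by (auto simp: rooted_sets_def)
    then have "S = (S \<union> T) \<inter> insert u X" "S' = (S' \<union> T') \<inter> insert u X"
      "T = (S \<union> T) \<inter> insert u Y" "T' = (S' \<union> T') \<inter> insert u Y"
      using assms(4-6) by auto
    then show "S = S' \<and> T = T'" using eq by simp
  qed
  moreover have "(\<lambda>(S, T). S \<union> T) ` (?RX \<times> ?RY) \<subseteq> rooted_sets E (insert u (X \<union> Y)) u"
    by (auto simp: rooted_sets_def intro: connected_on_Un)
  ultimately have "card (?RX \<times> ?RY) \<le> card (rooted_sets E (insert u (X \<union> Y)) u)"
    using assms(2,3) by (intro card_inj_on_le) (auto intro: finite_rooted_sets)
  moreover have "(card X + 1) * (card Y + 1) \<le> card ?RX * card ?RY"
    using card_rooted_sets_ge[OF assms(1) _ X, of u] card_rooted_sets_ge[OF assms(1) _ Y, of u] assms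
    by (intro mult_le_mono) auto
  ultimately show ?thesis by (simp add: card_cartesian_product)
qed

text \<open>
  If \<open>X\<close> is separated from the rest of \<open>A\<close> by the cut vertex \<open>u\<close>, then a cut of \<open>X\<close> together with \<open>u\<close>
  extends to a cut of \<open>A\<close> by adding the other branches to the part that contains \<open>u\<close>; the edge
  found in \<open>A\<close> cannot run into another branch.
\<close>

lemma connected_on_branch:
  assumes "connected_on E A" "u \<in> A" "X \<subseteq> A - {u}"
    and "\<And>x y. x \<in> X \<Longrightarrow> y \<in> A - {u} - X \<Longrightarrow> \<not> E x y \<and> \<not> E y x"
  shows "connected_on E (insert u X)"
proof (rule connected_onI)
  fix P assume P: "P \<subseteq> insert u X" "P \<noteq> insert u X" "P \<noteq> {}"
  show "\<exists>x\<in>P. \<exists>y\<in>insert u X - P. E x y"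
  proof (cases "u \<in> P")
    case True
    have "P \<union> (A - X) \<subseteq> A" "P \<union> (A - X) \<noteq> A" "P \<union> (A - X) \<noteq> {}" using P True assms(2,3) by auto
    then obtain x y where xy: "x \<in> P \<union> (A - X)" "y \<in> A" "y \<notin> P \<union> (A - X)" "E x y"
      using connected_onE[OF assms(1)] by metis
    then show ?thesis using assms(4)[of y x] True by blast
  next
    case False
    have "P \<subseteq> A" "P \<noteq> A" using P False assms(2,3) by auto
    then obtain x y where xy: "x \<in> P" "y \<in> A" "y \<notin> P" "E x y"
      using connected_onE[OF assms(1)] P by metis
    then show ?thesis using assms(4)[of x y] P False by blast
  qed
qed simp

definition component :: "('a \<Rightarrow> 'a \<Rightarrow> bool) \<Rightarrow> 'a set \<Rightarrow> 'a \<Rightarrow> 'a set" where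
  "component E S u = \<Union>(rooted_sets E S u)"

lemma component_subset: "component E S u \<subseteq> S"
  by (auto simp: component_def rooted_sets_def)

lemma component_refl: "u \<in> S \<Longrightarrow> u \<in> component E S u"
  unfolding component_def rooted_sets_def by (rule UnionI[of "{u}"]) simp_all

lemma connected_component:
  assumes "u \<in> S"
  shows "connected_on E (component E S u)"
proof -
  have "{u} \<in> rooted_sets E S u" using assms by (simp add: rooted_sets_def)
  then show ?thesis
    unfolding component_def by (intro connected_on_Union[where u = u]) (auto simp: rooted_sets_def)
qed

lemma component_closed:
  assumes "symp E" "x \<in> component E S u" "y \<in> S" "E x y"
  shows "y \<in> component E S u"
proof -
  obtain T where T: "T \<subseteq> S" "u \<in> T" "connected_on E T" "x \<in> T"
    using assms(2) by (auto simp: component_def rooted_sets_def)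
  have "insert y T \<in> rooted_sets E S u"
    using T assms connected_on_insert[OF assms(1) T(3,4) assms(4)] by (auto simp: rooted_sets_def)
  then show ?thesis by (auto simp: component_def)
qed

section \<open>Connected sets through a root\<close>

text \<open>
  A path that starts at the root \<open>u = h 0\<close> and whose last three vertices form a triangle, the only
  chord being the one that closes this triangle.
\<close>

definition rooted_tadpole :: "('a \<Rightarrow> 'a \<Rightarrow> bool) \<Rightarrow> 'a \<Rightarrow> 'a set \<Rightarrow> bool" where
  "rooted_tadpole E u A \<longleftrightarrow> 3 \<le> card A \<and>
     (\<exists>h. bij_betw h {..<card A} A \<and> h 0 = u \<and>
        (\<forall>i j. i < j \<longrightarrow> j < card A \<longrightarrow>
           (E (h i) (h j) \<longleftrightarrow> j = Suc i \<or> i + 3 = card A \<and> Suc j = card A)))"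

lemma rooted_tadpole_triangle:
  assumes "E u x" "E u y" "E x y" "u \<noteq> x" "u \<noteq> y" "x \<noteq> y"
  shows "rooted_tadpole E u {u, x, y}"
proof -
  define h :: "nat \<Rightarrow> 'a" where "h i = (if i = 0 then u else if i = 1 then x else y)" for i
  have c: "card {u, x, y} = 3" using assms by simp
  have l: "{..<3::nat} = {0, 1, 2}" by auto
  have "bij_betw h {..<3} {u, x, y}"
    using assms unfolding bij_betw_def l by (auto simp: h_def inj_on_def)
  moreover have "E (h i) (h j) \<longleftrightarrow> j = Suc i \<or> i + 3 = 3 \<and> Suc j = 3" if "i < j" "j < 3" for i j
  proof -
    have "i = 0 \<and> j = 1 \<or> i = 0 \<and> j = 2 \<or> i = 1 \<and> j = 2" using that by auto
    then show ?thesis using assms by (auto simp: h_def)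
  qed
  ultimately show ?thesis
    unfolding rooted_tadpole_def c by (intro conjI exI[of _ h]) (auto simp: h_def)
qed

lemma rooted_tadpole_insert:
  assumes "rooted_tadpole E u' A" "finite A" "u \<notin> A" and nbr: "\<And>y. y \<in> A \<Longrightarrow> E u y \<longleftrightarrow> y = u'"
  shows "rooted_tadpole E u (insert u A)"
proof -
  obtain h where h: "3 \<le> card A" "bij_betw h {..<card A} A" "h 0 = u'"
    and adj: "\<And>i j. i < j \<Longrightarrow> j < card A \<Longrightarrow>
      E (h i) (h j) \<longleftrightarrow> j = Suc i \<or> i + 3 = card A \<and> Suc j = card A"
    using assms(1) by (auto simp: rooted_tadpole_def)
  define k where "k i = (case i of 0 \<Rightarrow> u | Suc i' \<Rightarrow> h i')" for i
  have k: "k 0 = u" "\<And>i. k (Suc i) = h i" by (simp_all add: k_def)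
  have c: "card (insert u A) = Suc (card A)" using assms(2,3) by simp
  have "bij_betw k {..<Suc (card A)} (insert u A)"
  proof -
    have "k ` {..<Suc (card A)} = insert u A"
      unfolding lessThan_Suc_eq_insert_0 image_insert image_image k using h(2) by (simp add: bij_betw_def)
    then show ?thesis using c by (auto simp: bij_betw_def intro!: eq_card_imp_inj_on)
  qed
  moreover have "E (k i) (k j) \<longleftrightarrow> j = Suc i \<or> i + 3 = Suc (card A) \<and> Suc j = Suc (card A)"
    if ij: "i < j" "j < Suc (card A)" for i j
  proof -
    obtain j' where j': "j = Suc j'" using ij by (cases j) auto
    have j'A: "h j' \<in> A" using h(2) j' ij by (auto simp: bij_betw_def)
    show ?thesis
    proof (cases i)
      case 0
      have "h j' = u' \<longleftrightarrow> j' = 0"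
        using h j' ij inj_onD[of h "{..<card A}" j' 0] by (auto simp: bij_betw_def)
      then show ?thesis using 0 j' nbr[OF j'A] h(1) by (auto simp: k)
    next
      case (Suc i')
      then show ?thesis using adj[of i' j'] ij j' by (auto simp: k)
    qed
  qed
  ultimately show ?thesis
    unfolding rooted_tadpole_def c using h(1) by (intro conjI exI[of _ k]) (auto simp: k)
qed

text \<open>
  A chain of connected sets upwards from \<open>{u, x, y}\<close> together with \<open>{u}\<close>, \<open>{u, x}\<close> and \<open>{u, y}\<close> gives
  the bound. As soon as an edge leaves \<open>{u, x, y}\<close>, its end outside can be attached to one of these
  three small sets, which yields a further set without \<open>x\<close> or without \<open>y\<close>, hence off the chain.
\<close>

lemma card_rooted_sets_two_nbrs:
  assumes "symp E" "irreflp E" "finite A" "connected_on E A" "u \<in> A"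
    and xy: "x \<in> A" "y \<in> A" "x \<noteq> y" "E u x" "E u y"
    and deg: "\<And>w. w \<in> A - {u} \<Longrightarrow> two_nbrs E A w"
  shows "card A + 1 \<le> card (rooted_sets E A u) \<and>
    (card (rooted_sets E A u) = card A + 1 \<longrightarrow> A = {u, x, y} \<and> E x y)"
proof -
  have ne: "u \<noteq> x" "u \<noteq> y" using xy irreflpD[OF assms(2)] by metis+
  let ?S = "{u, x, y}"
  let ?F = "{T. ?S \<subseteq> T \<and> T \<subseteq> A \<and> connected_on E T}"
  let ?small = "{{u}, {u, x}, {u, y}}"
  have cux: "connected_on E {u, x}" and cuy: "connected_on E {u, y}"
    using connected_on_pair[OF assms(1)] xy by auto
  have "connected_on E ({u, x} \<union> {u, y})" using cux cuy by (rule connected_on_Un) auto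
  moreover have "{u, x} \<union> {u, y} = ?S" by auto
  ultimately have cS: "connected_on E ?S" by simp
  have "card A + 1 \<le> card ?S + card ?F"
    using connected_sets_between[OF assms(1,3,4) cS] assms(5) xy by simp
  then have F: "card A \<le> card ?F + 2" using ne xy by simp
  have finF: "finite ?F" using assms(3) by (auto intro: finite_subset[of _ "Pow A"])
  have small: "card ?small = 3" using ne xy by (auto simp: doubleton_eq_iff)
  have disj: "?F \<inter> ?small = {}" using ne xy by auto
  have sub: "?F \<union> ?small \<subseteq> rooted_sets E A u"
    using assms(5) xy cux cuy by (auto simp: rooted_sets_def)
  have fin: "finite (rooted_sets E A u)" using assms(3) by (rule finite_rooted_sets)
  have Us: "card (?F \<union> ?small) = card ?F + 3"
    using card_Un_disjoint[OF finF _ disj] small by simp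
  have "card (?F \<union> ?small) \<le> card (rooted_sets E A u)" by (rule card_mono[OF fin sub])
  then have 1: "card A + 1 \<le> card (rooted_sets E A u)" using F Us by simp
  have extra: "card A + 1 < card (rooted_sets E A u)"
    if T: "T \<in> rooted_sets E A u" "\<not> ?S \<subseteq> T" "T \<notin> ?small" for T
  proof -
    have "insert T (?F \<union> ?small) \<subseteq> rooted_sets E A u" using sub T(1) by blast
    then have "card (insert T (?F \<union> ?small)) \<le> card (rooted_sets E A u)"
      by (rule card_mono[OF fin])
    moreover have "card (insert T (?F \<union> ?small)) = Suc (card (?F \<union> ?small))"
      using T finF by (intro card_insert_disjoint) auto
    ultimately show ?thesis using F Us by simp
  qed
  have 2: "A = ?S \<and> E x y" if eq: "card (rooted_sets E A u) = card A + 1"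
  proof -
    have no_extra: "?S \<subseteq> T \<or> T \<in> ?small" if "T \<in> rooted_sets E A u" for T
      using extra[of T] that eq by auto
    have AS: "A = ?S"
    proof (rule ccontr)
      assume "A \<noteq> ?S"
      then obtain s z where sz: "s \<in> ?S" "z \<in> A" "z \<notin> ?S" "E s z"
        using connected_onE[OF assms(4), of ?S] assms(5) xy by blast
      consider "s = u" | "s = x" | "s = y" using sz by auto
      then show False
      proof cases
        case 1
        then have "{u, z} \<in> rooted_sets E A u"
          using sz assms(5) connected_on_pair[OF assms(1)] by (auto simp: rooted_sets_def)
        then show False using no_extra sz xy ne by blast
      next
        case 2
        then have "insert z {u, x} \<in> rooted_sets E A u"
          using sz assms(5) xy connected_on_insert[OF assms(1) cux, of x z] by (auto simp: rooted_sets_def)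
        then show False using no_extra sz xy ne by blast
      next
        case 3
        then have "insert z {u, y} \<in> rooted_sets E A u"
          using sz assms(5) xy connected_on_insert[OF assms(1) cuy, of y z] by (auto simp: rooted_sets_def)
        then show False using no_extra sz xy ne by blast
      qed
    qed
    have "two_nbrs E A x" using deg xy ne by auto
    then have "E x y" using irreflpD[OF assms(2), of x] by (auto simp: two_nbrs_def AS)
    then show ?thesis using AS by simp
  qed
  show ?thesis using 1 2 by blast
qed

text \<open>
  If the root has only one neighbour \<open>u'\<close>, the sets other than \<open>{u}\<close> arise from those through \<open>u'\<close>, so
  that one vertex accounts for one set and the path of the tadpole grows. The process stops
  at a vertex with two neighbours, where the preceding lemma provides the one additional set and, in
  case of equality, the triangle.
\<close>

lemma card_rooted_sets_tadpole:
  assumes "symp E" "irreflp E" "finite A" "connected_on E A" "u \<in> A" "A \<noteq> {u}"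
    and "\<And>w. w \<in> A - {u} \<Longrightarrow> two_nbrs E A w"
  shows "card A + 1 \<le> card (rooted_sets E A u) \<and>
    (card (rooted_sets E A u) = card A + 1 \<longrightarrow> rooted_tadpole E u A)"
  using assms(3-)
proof (induction "card A" arbitrary: A u rule: less_induct)
  case less
  note irr = irreflpD[OF assms(2)] and sym = sympD[OF assms(1)]
  obtain u' where u': "u' \<in> A" "u' \<noteq> u" "E u u'"
    using connected_onE[OF less.prems(2), of "{u}"] less.prems(3,4) by auto
  show ?case
  proof (cases "\<exists>y\<in>A. y \<noteq> u' \<and> E u y")
    case True
    then obtain y where y: "y \<in> A" "y \<noteq> u'" "E u y" by blast
    have "y \<noteq> u" using y irr by metis
    have *: "card A + 1 \<le> card (rooted_sets E A u) \<and>
      (card (rooted_sets E A u) = card A + 1 \<longrightarrow> A = {u, u', y} \<and> E u' y)"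
      by (rule card_rooted_sets_two_nbrs[OF assms(1,2) less.prems(1-3)]) (use u' y less.prems(5) in auto)
    then show ?thesis using rooted_tadpole_triangle[of E u u' y] u' y \<open>y \<noteq> u\<close> by metis
  next
    case False
    then have uniq: "\<And>y. y \<in> A \<Longrightarrow> E u y \<longleftrightarrow> y = u'" using u' by blast
    let ?A = "A - {u}"
    have A: "A = insert u ?A" using less.prems(3) by auto
    have cA: "card A = Suc (card ?A)"
      using less.prems(1,3) card_Suc_Diff1 by metis
    have conn: "connected_on E ?A"
    proof (rule connected_onI)
      show "?A \<noteq> {}" using u' by auto
      fix P assume P: "P \<subseteq> ?A" "P \<noteq> ?A" "P \<noteq> {}"
      show "\<exists>x\<in>P. \<exists>y\<in>?A - P. E x y"
      proof (cases "u' \<in> P")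
        case True
        obtain x y where "x \<in> insert u P" "y \<in> A" "y \<notin> insert u P" "E x y"
          using connected_onE[OF less.prems(2), of "insert u P"] P less.prems(3) by blast
        then show ?thesis using uniq True by blast
      next
        case False
        obtain x y where "x \<in> P" "y \<in> A" "y \<notin> P" "E x y"
          using connected_onE[OF less.prems(2), of P] P less.prems(3) by blast
        then show ?thesis using uniq[of x] sym False P by blast
      qed
    qed
    have ne: "?A \<noteq> {u'}"
    proof
      assume "?A = {u'}"
      then have "A = {u, u'}" using A by auto
      then show False using less.prems(5)[of u'] u' irr[of u'] by (auto simp: two_nbrs_def)
    qed
    have deg: "two_nbrs E ?A w" if "w \<in> ?A - {u'}" for w
    proof -
      have "\<not> E w u" using that uniq sym by blast
      moreover have "two_nbrs E A w" using less.prems(5) that by blast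
      ultimately show ?thesis by (auto simp: two_nbrs_def)
    qed
    have IH: "card ?A + 1 \<le> card (rooted_sets E ?A u') \<and>
      (card (rooted_sets E ?A u') = card ?A + 1 \<longrightarrow> rooted_tadpole E u' ?A)"
      using u' cA less.prems(1) conn ne deg by (intro less.hyps) auto
    \<comment> \<open>every connected set through \<open>u'\<close> off \<open>u\<close> extends by \<open>u\<close>, and \<open>{u}\<close> itself is new\<close>
    let ?R = "insert {u} (insert u ` rooted_sets E ?A u')"
    have fin: "finite (rooted_sets E ?A u')" using less.prems(1) by (simp add: finite_rooted_sets)
    have "?R \<subseteq> rooted_sets E A u"
      using less.prems(3) u' connected_on_insert[OF assms(1) _ _ sym[OF u'(3)]]
      by (auto simp: rooted_sets_def)
    then have "card ?R \<le> card (rooted_sets E A u)"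
      using finite_rooted_sets[OF less.prems(1)] by (rule card_mono[rotated])
    moreover have "inj_on (insert u) (rooted_sets E ?A u')"
      by (rule inj_onI) (auto simp: rooted_sets_def)
    then have "card (insert u ` rooted_sets E ?A u') = card (rooted_sets E ?A u')"
      by (rule card_image)
    moreover have "{u} \<notin> insert u ` rooted_sets E ?A u'" using u' by (auto simp: rooted_sets_def)
    ultimately have step: "Suc (card (rooted_sets E ?A u')) \<le> card (rooted_sets E A u)"
      using fin by simp
    have "rooted_tadpole E u A" if "card (rooted_sets E A u) = card A + 1"
    proof -
      have "rooted_tadpole E u' ?A" using IH step that cA by auto
      then have "rooted_tadpole E u (insert u ?A)"
        by (rule rooted_tadpole_insert) (use less.prems(1) uniq in auto)
      then show ?thesis using A by simp
    qed
    then show ?thesis using IH step cA by auto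
  qed
qed

section \<open>Contracting an edge\<close>

text \<open>
  Contraction of \<open>uv\<close>, to be read on the vertex set without \<open>v\<close>: the vertex \<open>u\<close> plays the part of the
  merged vertex. The first conjunct removes the loop at \<open>u\<close>.
\<close>

definition contract :: "('a \<Rightarrow> 'a \<Rightarrow> bool) \<Rightarrow> 'a \<Rightarrow> 'a \<Rightarrow> 'a \<Rightarrow> 'a \<Rightarrow> bool" where
  "contract E u v a b \<longleftrightarrow> a \<noteq> b \<and> (E a b \<or> a = u \<and> E v b \<or> b = u \<and> E a v)"

lemma symp_contract: "symp E \<Longrightarrow> symp (contract E u v)"
  by (rule sympI) (auto simp: contract_def dest: sympD)

lemma irreflp_contract: "irreflp (contract E u v)"
  by (rule irreflpI) (simp add: contract_def)

text \<open>
  A cut of the contracted graph becomes a cut of the original one when \<open>v\<close> is put on the side of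
  \<open>u\<close>; conversely below, where in addition a cut that separates \<open>u\<close> from \<open>v\<close> is crossed by \<open>uv\<close>.
\<close>

lemma connected_on_contract:
  assumes "connected_on E V" "u \<in> V" "v \<in> V" "u \<noteq> v"
  shows "connected_on (contract E u v) (V - {v})"
proof (rule connected_onI)
  show "V - {v} \<noteq> {}" using assms by auto
  fix P assume P: "P \<subseteq> V - {v}" "P \<noteq> V - {v}" "P \<noteq> {}"
  show "\<exists>x\<in>P. \<exists>y\<in>V - {v} - P. contract E u v x y"
  proof (cases "u \<in> P")
    case True
    obtain x y where xy: "x \<in> insert v P" "y \<in> V" "y \<notin> insert v P" "E x y"
      using connected_onE[OF assms(1), of "insert v P"] P assms(3) by blast
    show ?thesis
    proof (cases "x = v")
      case True
      then have "contract E u v u y" using xy \<open>u \<in> P\<close> by (auto simp: contract_def)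
      then show ?thesis using xy \<open>u \<in> P\<close> by blast
    next
      case False
      then have "contract E u v x y" using xy by (auto simp: contract_def)
      then show ?thesis using xy False by blast
    qed
  next
    case False
    obtain x y where xy: "x \<in> P" "y \<in> V" "y \<notin> P" "E x y"
      using connected_onE[OF assms(1), of P] P assms(3) by blast
    show ?thesis
    proof (cases "y = v")
      case True
      then have "contract E u v x u" using xy False by (auto simp: contract_def)
      then show ?thesis using xy False assms(2,4) by blast
    next
      case False
      then have "contract E u v x y" using xy by (auto simp: contract_def)
      then show ?thesis using xy False by blast
    qed
  qed
qed

lemma connected_on_uncontract:
  assumes "symp E" "E u v" "connected_on (contract E u v) S" "v \<notin> S"
  shows "connected_on E (if u \<in> S then insert v S else S)"
proof (cases "u \<in> S")
  case False
  then show ?thesis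
    using connected_on_mono[OF assms(3), of E] by (auto simp: contract_def)
next
  case True
  have "connected_on E (insert v S)"
  proof (rule connected_onI)
    fix P assume P: "P \<subseteq> insert v S" "P \<noteq> insert v S" "P \<noteq> {}"
    show "\<exists>x\<in>P. \<exists>y\<in>insert v S - P. E x y"
    proof (cases "u \<in> P \<longleftrightarrow> v \<in> P")
      case False
      then show ?thesis using assms(1,2) True by (blast dest: sympD)
    next
      case same: True
      have "P - {v} \<subseteq> S" "P - {v} \<noteq> S" "P - {v} \<noteq> {}" using P same True assms(4) by auto
      then obtain x y where "x \<in> P - {v}" "y \<in> S" "y \<notin> P - {v}" "contract E u v x y"
        using connected_onE[OF assms(3)] by metis
      then show ?thesis using same assms(4) True by (auto simp: contract_def)
    qed
  qed simp
  then show ?thesis using True by simp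
qed

text \<open>
  Since \<open>u\<close> and \<open>v\<close> have no common neighbour, the neighbours of any other vertex stay distinct when
  \<open>v\<close> is merged into \<open>u\<close>, and the merged vertex keeps a neighbour of \<open>u\<close> as well as one of \<open>v\<close>.
\<close>

lemma two_nbrs_contract:
  assumes "symp E" "irreflp E" "u \<in> V" "v \<in> V" "E u v"
    and no_triangle: "\<And>w. w \<in> V \<Longrightarrow> \<not> (E u w \<and> E v w)"
    and deg: "\<And>w. w \<in> V \<Longrightarrow> two_nbrs E V w"
    and w: "w \<in> V - {v}"
  shows "two_nbrs (contract E u v) (V - {v}) w"
proof -
  note irr = irreflpD[OF assms(2)] and sym = sympD[OF assms(1)]
  show ?thesis
  proof (cases "w = u")
    case True
    obtain y where y: "y \<in> V" "y \<noteq> v" "E u y"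
      using deg[OF assms(3)] by (auto simp: two_nbrs_def)
    obtain z where z: "z \<in> V" "z \<noteq> u" "E v z"
      using deg[OF assms(4)] by (auto simp: two_nbrs_def)
    have "y \<noteq> z" "y \<noteq> u" "z \<noteq> v" using y z no_triangle irr by metis+
    then show ?thesis
      unfolding two_nbrs_def using y z True
      by (intro bexI[of _ y] bexI[of _ z]) (auto simp: contract_def)
  next
    case False
    obtain y z where yz: "y \<in> V" "z \<in> V" "y \<noteq> z" "E w y" "E w z"
      using deg[of w] w by (auto simp: two_nbrs_def)
    define m where "m x = (if x = v then u else x)" for x
    have m: "m x \<in> V - {v} \<and> contract E u v w (m x)" if "x \<in> V" "E w x" for x
      using that irr[of w] irr[of v] assms(3-5) False by (auto simp: m_def contract_def)
    have "m y \<noteq> m z"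
      using yz no_triangle[of w] w sym by (auto simp: m_def)
    then show ?thesis unfolding two_nbrs_def using m[of y] m[of z] yz by blast
  qed
qed

text \<open>
  Undoing the contraction yields connected sets containing both or none of \<open>u\<close> and \<open>v\<close>; the sets that
  contain exactly one of them are counted through their roots.
\<close>

lemma card_connected_sets_contract:
  assumes "symp E" "finite V" "E u v" "u \<in> V" "v \<in> V" "u \<noteq> v"
    and "A \<subseteq> V - {v}" "B \<subseteq> V - {u}"
  shows "card (connected_sets (contract E u v) (V - {v}))
      + card (rooted_sets E A u) + card (rooted_sets E B v) \<le> card (connected_sets E V)"
proof -
  let ?C = "connected_sets (contract E u v) (V - {v})"
  define m where "m S = (if u \<in> S then insert v S else S)" for S
  have inj: "inj_on m ?C"
  proof (rule inj_onI)
    fix S T assume "S \<in> ?C" "T \<in> ?C" and eq: "m S = m T"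
    then have "v \<notin> S" "v \<notin> T" by (auto simp: connected_sets_def)
    then have "S = m S - {v}" "T = m T - {v}" by (auto simp: m_def)
    then show "S = T" using eq by metis
  qed
  have m: "m S \<in> connected_sets E V" if "S \<in> ?C" for S
  proof -
    have "v \<notin> S" using that by (auto simp: connected_sets_def)
    then show ?thesis
      using that connected_on_uncontract[OF assms(1,3), of S] assms(5)
      by (auto simp: connected_sets_def m_def)
  qed
  have uv: "u \<in> S \<longleftrightarrow> v \<in> S" if "S \<in> m ` ?C" for S
    using that assms(6) by (auto simp: m_def connected_sets_def split: if_splits)
  have RA: "u \<in> S \<and> v \<notin> S" if "S \<in> rooted_sets E A u" for S
    using that assms(7) by (auto simp: rooted_sets_def)
  have RB: "v \<in> S \<and> u \<notin> S" if "S \<in> rooted_sets E B v" for S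
    using that assms(8) by (auto simp: rooted_sets_def)
  have finA: "finite (rooted_sets E A u)" and finB: "finite (rooted_sets E B v)"
    and finC: "finite (m ` ?C)"
    using assms(2,7,8)
    by (auto intro!: finite_rooted_sets finite_imageI finite_connected_sets intro: finite_subset)
  have "card (m ` ?C \<union> rooted_sets E A u) = card (m ` ?C) + card (rooted_sets E A u)"
    using finC finA uv RA by (intro card_Un_disjoint) blast+
  moreover have "card (m ` ?C \<union> rooted_sets E A u \<union> rooted_sets E B v)
      = card (m ` ?C \<union> rooted_sets E A u) + card (rooted_sets E B v)"
    using finC finA finB uv RA RB by (intro card_Un_disjoint) blast+
  moreover have "m ` ?C \<union> rooted_sets E A u \<union> rooted_sets E B v \<subseteq> connected_sets E V"
    using m assms(7,8) by (auto simp: rooted_sets_def connected_sets_def)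
  then have "card (m ` ?C \<union> rooted_sets E A u \<union> rooted_sets E B v) \<le> card (connected_sets E V)"
    by (rule card_mono[OF finite_connected_sets[OF assms(2)]])
  ultimately show ?thesis using card_image[OF inj] by simp
qed

section \<open>Graphs with a dominating vertex\<close>

text \<open>
  Every set that contains the dominating vertex \<open>c\<close> is connected. In addition there are the
  singletons other than \<open>{c}\<close> and, by the degree condition, some edges that avoid \<open>c\<close>: two of them
  if at least three vertices differ from \<open>c\<close>.
\<close>

lemma card_connected_sets_dominating:
  assumes "symp E" "irreflp E" "finite V" "3 \<le> card V" "c \<in> V"
    and dom: "\<And>x. x \<in> V \<Longrightarrow> x \<noteq> c \<Longrightarrow> E c x"
    and deg: "\<And>x. x \<in> V \<Longrightarrow> two_nbrs E V x"
  shows "2 ^ (card V - 1) + card V \<le> card (connected_sets E V)"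
    and "4 \<le> card V \<Longrightarrow> 2 ^ (card V - 1) + card V + 1 \<le> card (connected_sets E V)"
proof -
  note irr = irreflpD[OF assms(2)] and sym = sympD[OF assms(1)]
  let ?W = "V - {c}"
  have finW: "finite ?W" using assms(3) by simp
  have cW: "card ?W = card V - 1" using assms(3,5) by simp
  have nb: "\<exists>y\<in>?W. y \<noteq> x \<and> E x y" if x: "x \<in> ?W" for x
  proof -
    obtain y z where "y \<in> V" "z \<in> V" "y \<noteq> z" "E x y" "E x z"
      using deg[of x] x unfolding two_nbrs_def by blast
    moreover from this have "y \<noteq> x" "z \<noteq> x" using irr by metis+
    ultimately show ?thesis by blast
  qed
  have "?W \<noteq> {}"
  proof
    assume "?W = {}"
    then have "card ?W = 0" by (simp only: card.empty)
    then show False using cW assms(4) by simp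
  qed
  then obtain x where x: "x \<in> ?W" by blast
  obtain x' where x': "x' \<in> ?W" "x' \<noteq> x" "E x x'" using nb[OF x] by blast
  let ?C = "insert c ` Pow ?W" and ?S = "(\<lambda>x. {x}) ` ?W"
  have bound: "2 ^ (card V - 1) + (card V - 1) + card P \<le> card (connected_sets E V)"
    if P: "finite P" "P \<subseteq> connected_sets E V" "\<And>e. e \<in> P \<Longrightarrow> e \<subseteq> ?W \<and> card e = 2" for P
  proof -
    have "connected_on E (insert c S)" if "S \<subseteq> ?W" for S
    proof -
      have "connected_on E (\<Union>(insert {c} ((\<lambda>x. {c, x}) ` S)))"
        using that dom connected_on_pair[OF assms(1)] by (intro connected_on_Union[where u = c]) auto
      moreover have "\<Union>(insert {c} ((\<lambda>x. {c, x}) ` S)) = insert c S" by auto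
      ultimately show ?thesis by simp
    qed
    then have C: "?C \<subseteq> connected_sets E V" using assms(5) by (auto simp: connected_sets_def)
    have S: "?S \<subseteq> connected_sets E V" by (auto simp: connected_sets_def)
    have "inj_on (insert c) (Pow ?W)" by (rule inj_onI) blast
    then have cC: "card ?C = 2 ^ (card V - 1)"
      using finW cW by (simp add: card_image card_Pow)
    have cS: "card ?S = card V - 1" using cW by (simp add: card_image)
    have CS: "?C \<inter> ?S = {}" by auto
    have "?C \<inter> P = {}" using P(3) by blast
    moreover have "?S \<inter> P = {}" using P(3) by fastforce
    ultimately have CSP: "(?C \<union> ?S) \<inter> P = {}" by blast
    have "card (?C \<union> ?S \<union> P) = 2 ^ (card V - 1) + (card V - 1) + card P"
      using finW CS CSP cC cS P(1) by (simp add: card_Un_disjoint)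
    moreover have "card (?C \<union> ?S \<union> P) \<le> card (connected_sets E V)"
      using C S P finite_connected_sets[OF assms(3)] by (intro card_mono) auto
    ultimately show ?thesis by simp
  qed
  have edge: "{a, b} \<in> connected_sets E V \<and> {a, b} \<subseteq> ?W \<and> card {a, b} = 2"
    if "a \<in> ?W" "b \<in> ?W" "b \<noteq> a" "E a b" for a b
    using that connected_on_pair[OF assms(1)] by (auto simp: connected_sets_def)
  show "2 ^ (card V - 1) + card V \<le> card (connected_sets E V)"
    using bound[of "{{x, x'}}"] edge[OF x x'] assms(4) by simp
  assume n: "4 \<le> card V"
  have "\<not> ?W \<subseteq> {x, x'}"
  proof
    assume "?W \<subseteq> {x, x'}"
    then have "card ?W \<le> card {x, x'}" by (rule card_mono[rotated]) simp
    then show False using cW n x' by simp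
  qed
  then obtain y where y: "y \<in> ?W" "y \<notin> {x, x'}" by blast
  obtain y' where y': "y' \<in> ?W" "y' \<noteq> y" "E y y'" using nb[OF y(1)] by blast
  have "{x, x'} \<noteq> {y, y'}" using y by auto
  then have "card {{x, x'}, {y, y'}} = 2" by simp
  moreover have "2 ^ (card V - 1) + (card V - 1) + card {{x, x'}, {y, y'}} \<le> card (connected_sets E V)"
    using edge[OF x x'] edge[OF y(1) y'] by (intro bound) blast+
  ultimately show "2 ^ (card V - 1) + card V + 1 \<le> card (connected_sets E V)" using n by simp
qed

section \<open>The two sides of an edge\<close>

text \<open>
  The component of \<open>u\<close> after removal of \<open>v\<close> and the component of \<open>v\<close> after removal of \<open>u\<close> are called
  the sides of the edge \<open>uv\<close>. They are disjoint exactly if the edge is a bridge.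
\<close>

lemma sides_cover:
  assumes "symp E" "connected_on E V" "u \<in> V" "v \<in> V" "u \<noteq> v"
  shows "component E (V - {v}) u \<union> component E (V - {u}) v = V"
proof (rule ccontr)
  let ?A = "component E (V - {v}) u" and ?B = "component E (V - {u}) v"
  assume ne: "?A \<union> ?B \<noteq> V"
  have uA: "u \<in> ?A" and vB: "v \<in> ?B" using assms by (auto intro: component_refl)
  have "?A \<union> ?B \<subseteq> V" using component_subset[of E "V - {v}" u] component_subset[of E "V - {u}" v] by blast
  then obtain x y where "x \<in> ?A \<union> ?B" "y \<in> V" "y \<notin> ?A \<union> ?B" "E x y"
    using connected_onE[OF assms(2) _ ne] uA by blast
  then show False
    using component_closed[OF assms(1), of x "V - {v}" u y]
      component_closed[OF assms(1), of x "V - {u}" v y] uA vB by blast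
qed

text \<open>
  The shape of \<open>D\<^sub>n\<close> as it comes out of the equality case: two tadpoles with a bridge between
  their roots.
\<close>

definition joined_tadpoles :: "('a \<Rightarrow> 'a \<Rightarrow> bool) \<Rightarrow> 'a set \<Rightarrow> bool" where
  "joined_tadpoles E V \<longleftrightarrow> (\<exists>A B u v. A \<union> B = V \<and> A \<inter> B = {} \<and>
     rooted_tadpole E u A \<and> rooted_tadpole E v B \<and> (\<forall>x\<in>A. \<forall>y\<in>B. E x y \<longleftrightarrow> x = u \<and> y = v))"

lemma bridge_sides:
  assumes "symp E" "u \<in> V" "v \<in> V" "u \<noteq> v"
    and disj: "component E (V - {v}) u \<inter> component E (V - {u}) v = {}"
    and xy: "x \<in> component E (V - {v}) u" "y \<in> component E (V - {u}) v" "E x y"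
  shows "x = u \<and> y = v"
proof -
  have sub: "component E (V - {v}) u \<subseteq> V - {v}" "component E (V - {u}) v \<subseteq> V - {u}"
    by (rule component_subset)+
  have "y = v" 
    using component_closed[OF assms(1) xy(1) _ xy(3)] disj xy(2) sub by blast
  moreover have "x = u"
    using component_closed[OF assms(1) xy(2) _ sympD[OF assms(1) xy(3)]] disj xy(1) sub by blast
  ultimately show ?thesis by simp
qed

text \<open>
  A vertex of one side other than the end of the bridge has all its neighbours on the same side, so
  that a side is a rooted graph to which the bound for tadpoles applies.
\<close>

lemma bridge_side_nbrs:
  assumes "symp E" "irreflp E" "u \<in> V" "v \<in> V" "E u v" "connected_on E V"
    and deg: "\<And>x. x \<in> V \<Longrightarrow> two_nbrs E V x"
    and disj: "component E (V - {v}) u \<inter> component E (V - {u}) v = {}"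
  shows "component E (V - {v}) u \<noteq> {u}"
    and "w \<in> component E (V - {v}) u - {u} \<Longrightarrow> two_nbrs E (component E (V - {v}) u) w"
proof -
  let ?A = "component E (V - {v}) u"
  have uv: "u \<noteq> v" using irreflpD[OF assms(2), of u] assms(5) by metis
  have uA: "u \<in> ?A" using assms uv by (auto intro: component_refl)
  have sub: "?A \<subseteq> V - {v}" by (rule component_subset)
  have vB: "v \<in> component E (V - {u}) v" using assms uv by (auto intro: component_refl)
  obtain y where y: "y \<in> V" "y \<noteq> v" "E u y"
    using deg[OF assms(3)] by (auto simp: two_nbrs_def)
  then have "y \<in> ?A" using component_closed[OF assms(1) uA] by blast
  moreover have "y \<noteq> u" using y irreflpD[OF assms(2)] by metis
  ultimately show "?A \<noteq> {u}" by blast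
  assume w: "w \<in> ?A - {u}"
  have "z \<in> ?A" if "z \<in> V" "E w z" for z
  proof -
    have "z \<noteq> v" using bridge_sides[OF assms(1,3,4) uv disj _ vB, of w] w that by blast
    then show ?thesis using component_closed[OF assms(1)] w that by blast
  qed
  moreover have "two_nbrs E V w" using deg w sub by blast
  ultimately show "two_nbrs E ?A w" unfolding two_nbrs_def by blast
qed

lemma card_rooted_sets_bridge:
  assumes "symp E" "irreflp E" "finite V" "u \<in> V" "v \<in> V" "E u v" "connected_on E V"
    and deg: "\<And>x. x \<in> V \<Longrightarrow> two_nbrs E V x"
    and disj: "component E (V - {v}) u \<inter> component E (V - {u}) v = {}"
  shows "card V + 2 \<le> card (rooted_sets E (component E (V - {v}) u) u)
      + card (rooted_sets E (component E (V - {u}) v) v)"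
    and "card (rooted_sets E (component E (V - {v}) u) u)
      + card (rooted_sets E (component E (V - {u}) v) v) = card V + 2 \<Longrightarrow> joined_tadpoles E V"
proof -
  let ?A = "component E (V - {v}) u" and ?B = "component E (V - {u}) v"
  have uv: "u \<noteq> v" using irreflpD[OF assms(2), of u] assms(6) by metis
  have uA: "u \<in> ?A" and vB: "v \<in> ?B" using assms uv by (auto intro: component_refl)
  have conn: "connected_on E ?A" "connected_on E ?B" using assms uv by (auto intro: connected_component)
  have cover: "?A \<union> ?B = V" using sides_cover assms uv by metis
  then have fin: "finite ?A" "finite ?B" using assms(3) by (metis finite_Un)+
  have n: "card V = card ?A + card ?B" using card_Un_disjoint[OF fin disj] cover by simp
  have disj': "?B \<inter> ?A = {}" using disj by blast
  have A: "card ?A + 1 \<le> card (rooted_sets E ?A u) \<and>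
      (card (rooted_sets E ?A u) = card ?A + 1 \<longrightarrow> rooted_tadpole E u ?A)"
    using bridge_side_nbrs[OF assms(1,2,4-7) deg disj]
    by (intro card_rooted_sets_tadpole[OF assms(1,2) fin(1) conn(1) uA]) auto
  have B: "card ?B + 1 \<le> card (rooted_sets E ?B v) \<and>
      (card (rooted_sets E ?B v) = card ?B + 1 \<longrightarrow> rooted_tadpole E v ?B)"
    using bridge_side_nbrs[OF assms(1,2,5,4) sympD[OF assms(1,6)] assms(7) deg disj']
    by (intro card_rooted_sets_tadpole[OF assms(1,2) fin(2) conn(2) vB]) auto
  show "card V + 2 \<le> card (rooted_sets E ?A u) + card (rooted_sets E ?B v)" using A B n by simp
  assume eq: "card (rooted_sets E ?A u) + card (rooted_sets E ?B v) = card V + 2"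
  then have "rooted_tadpole E u ?A" "rooted_tadpole E v ?B" using A B n by auto
  moreover have "E x y \<longleftrightarrow> x = u \<and> y = v" if "x \<in> ?A" "y \<in> ?B" for x y
    using bridge_sides[OF assms(1,4,5) uv disj that] assms(6) by blast
  ultimately show "joined_tadpoles E V"
    unfolding joined_tadpoles_def using cover disj by blast
qed

text \<open>
  Let \<open>I\<close> be the overlap of the sides, \<open>i\<close> its size, and let \<open>X\<close> and \<open>Y\<close> be the vertices that belong
  to one side only. There are no edges from \<open>I\<close> to \<open>X\<close> or \<open>Y\<close>, so the sides are glued at their roots
  from \<open>I\<close> and \<open>X\<close> and from \<open>I\<close> and \<open>Y\<close>, respectively. The product bound then gives at least
  \<open>(i + 1)(n - i)\<close> sets, and \<open>2 \<le> i \<le> n - 2\<close> makes this at least \<open>2n - 2\<close>.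
\<close>

lemma card_rooted_sets_cycle:
  assumes "symp E" "irreflp E" "finite V" "u \<in> V" "v \<in> V" "E u v" "connected_on E V"
    and no_triangle: "\<And>w. w \<in> V \<Longrightarrow> \<not> (E u w \<and> E v w)"
    and meet: "component E (V - {v}) u \<inter> component E (V - {u}) v \<noteq> {}"
  shows "2 * card V - 2 \<le> card (rooted_sets E (component E (V - {v}) u) u)
      + card (rooted_sets E (component E (V - {u}) v) v)"
proof -
  let ?A = "component E (V - {v}) u" and ?B = "component E (V - {u}) v"
  let ?I = "?A \<inter> ?B"
  let ?X = "?A - ?B - {u}" and ?Y = "?B - ?A - {v}"
  note sym = sympD[OF assms(1)]
  have uv: "u \<noteq> v" using irreflpD[OF assms(2), of u] assms(6) by metis
  have uA: "u \<in> ?A" and vB: "v \<in> ?B" using assms uv by (auto intro: component_refl)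
  have conn: "connected_on E ?A" "connected_on E ?B" using assms uv by (auto intro: connected_component)
  have cover: "?A \<union> ?B = V" using sides_cover assms uv by metis
  then have fin: "finite ?A" "finite ?B" using assms(3) by (metis finite_Un)+
  have sub: "?A \<subseteq> V - {v}" "?B \<subseteq> V - {u}" by (rule component_subset)+
  have no_edge: "\<not> E x y \<and> \<not> E y x" if "x \<in> ?I" "y \<in> ?X \<union> ?Y" for x y
    using that component_closed[OF assms(1), of x "V - {u}" v y]
      component_closed[OF assms(1), of x "V - {v}" u y] sub sym by blast
  have A: "?A = insert u (?I \<union> ?X)" and B: "?B = insert v (?I \<union> ?Y)" using uA vB by auto
  have cA: "connected_on E (insert u ?I)" "connected_on E (insert u ?X)"
    by (rule connected_on_branch[OF conn(1) uA]; use no_edge sub in blast)+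
  have cB: "connected_on E (insert v ?I)" "connected_on E (insert v ?Y)"
    by (rule connected_on_branch[OF conn(2) vB]; use no_edge sub in blast)+
  have uI: "u \<notin> ?I" and vI: "v \<notin> ?I" using sub by auto
  obtain x where x: "x \<in> ?I" "E u x"
    using connected_onE[OF cA(1), of "{u}"] meet uI by blast
  obtain y where y: "y \<in> ?I" "E v y"
    using connected_onE[OF cB(1), of "{v}"] meet vI by blast
  have "x \<noteq> y" using no_triangle[of x] x y sub by blast
  then have "card {x, y} = 2" by simp
  moreover have "card {x, y} \<le> card ?I" using x y fin by (intro card_mono) auto
  ultimately have i: "2 \<le> card ?I" by simp
  have "(card ?I + 1) * (card ?X + 1) \<le> card (rooted_sets E (insert u (?I \<union> ?X)) u)"
    using fin uI cA by (intro card_rooted_sets_glued[OF assms(1)]) auto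
  then have RA: "(card ?I + 1) * (card ?X + 1) \<le> card (rooted_sets E ?A u)" using A by simp
  have "(card ?I + 1) * (card ?Y + 1) \<le> card (rooted_sets E (insert v (?I \<union> ?Y)) v)"
    using fin vI cB by (intro card_rooted_sets_glued[OF assms(1)]) auto
  then have RB: "(card ?I + 1) * (card ?Y + 1) \<le> card (rooted_sets E ?B v)" using B by simp
  have "card ?A = Suc (card (?I \<union> ?X))"
    using fin uI by (subst (1) A, subst card_insert_disjoint) auto
  also have "card (?I \<union> ?X) = card ?I + card ?X" using fin by (intro card_Un_disjoint) auto
  finally have "card ?A = Suc (card ?I + card ?X)" .
  moreover have "V = ?A \<union> insert v ?Y" using cover vB by blast
  then have "card V = card ?A + card (insert v ?Y)"
    using card_Un_disjoint[of ?A "insert v ?Y"] fin sub by auto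
  moreover have "card (insert v ?Y) = Suc (card ?Y)" using fin by (intro card_insert_disjoint) auto
  ultimately have n: "card V = card ?I + card ?X + card ?Y + 2" by simp
  have "2 * (card ?X + card ?Y) \<le> card ?I * (card ?X + card ?Y)" using i by (rule mult_le_mono1)
  then show ?thesis using RA RB n by (simp add: algebra_simps)
qed

section \<open>The lower bound\<close>

text \<open>
  Up to five vertices this is the number of connected sets of a cycle, afterwards the number of
  connected sets of the double tadpole.
\<close>

definition min_count :: "nat \<Rightarrow> nat" where
  "min_count n = (if n \<le> 5 then n * (n - 1) + 1 else (n - 1) * (n + 6) div 2)"

lemma min_count_small: "min_count 3 = 7" "min_count 4 = 13" "min_count 5 = 21" "min_count 6 = 30"
  by (simp_all add: min_count_def)

lemma min_count_step:
  assumes "7 \<le> n"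
  shows "min_count n = min_count (n - 1) + n + 2"
proof -
  obtain m where m: "n = m + 7" using assms by (metis le_add_diff_inverse2)
  have "(m + 6) * (m + 13) = (m + 5) * (m + 12) + (m + 9) * 2" by (simp add: algebra_simps)
  then have "(m + 6) * (m + 13) div 2 = (m + 5) * (m + 12) div 2 + (m + 9)" by simp
  then show ?thesis by (simp add: min_count_def m ac_simps)
qed

lemma triangle_side_dominated:
  assumes "finite A" "card A \<le> 3" "irreflp E" "symp E" "u \<in> A" "w \<in> A - {u}" "two_nbrs E A w"
  shows "E u w"
proof -
  obtain y z where yz: "y \<in> A" "z \<in> A" "y \<noteq> z" "E w y" "E w z"
    using assms(7) unfolding two_nbrs_def by blast
  then have "y \<noteq> w" "z \<noteq> w" using irreflpD[OF assms(3)] by metis+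
  then have "card {w, y, z} = 3" using yz by simp
  then have "{w, y, z} = A" using assms yz by (intro card_seteq) auto
  then have "E w u" using assms(5,6) yz by auto
  then show ?thesis by (rule sympD[OF assms(4)])
qed

text \<open>
  Each side of a bridge has at least three vertices. If there are six vertices, both sides are
  triangles, and contracting the bridge leaves two triangles with a common vertex, which
  dominates.
\<close>

lemma card_connected_sets_two_triangles:
  assumes "symp E" "irreflp E" "finite V" "u \<in> V" "v \<in> V" "E u v" "connected_on E V"
    and deg: "\<And>x. x \<in> V \<Longrightarrow> two_nbrs E V x"
    and deg': "\<And>x. x \<in> V - {v} \<Longrightarrow> two_nbrs (contract E u v) (V - {v}) x"
    and disj: "component E (V - {v}) u \<inter> component E (V - {u}) v = {}"
  shows "6 \<le> card V"
    and "card V = 6 \<Longrightarrow> 22 \<le> card (connected_sets (contract E u v) (V - {v}))"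
proof -
  let ?A = "component E (V - {v}) u" and ?B = "component E (V - {u}) v"
  have uv: "u \<noteq> v" using irreflpD[OF assms(2), of u] assms(6) by metis
  have uA: "u \<in> ?A" and vB: "v \<in> ?B" using assms uv by (auto intro: component_refl)
  have cover: "?A \<union> ?B = V" using sides_cover assms uv by metis
  then have fin: "finite ?A" "finite ?B" using assms(3) by (metis finite_Un)+
  have n: "card V = card ?A + card ?B" using card_Un_disjoint[OF fin disj] cover by simp
  have disj': "?B \<inter> ?A = {}" using disj by blast
  note A = bridge_side_nbrs[OF assms(1,2,4-7) deg disj]
  note B = bridge_side_nbrs[OF assms(1,2,5,4) sympD[OF assms(1,6)] assms(7) deg disj']
  have three: "3 \<le> card W" if W: "finite W" "w \<in> W" "two_nbrs E W w" for W w
  proof -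
    obtain y z where yz: "y \<in> W" "z \<in> W" "y \<noteq> z" "E w y" "E w z"
      using W(3) unfolding two_nbrs_def by blast
    then have "y \<noteq> w" "z \<noteq> w" using irreflpD[OF assms(2)] by metis+
    then have "card {w, y, z} = 3" using yz by simp
    then show ?thesis using card_mono[OF W(1), of "{w, y, z}"] W(2) yz by simp
  qed
  obtain a where a: "a \<in> ?A - {u}" using A(1) uA by blast
  obtain b where b: "b \<in> ?B - {v}" using B(1) vB by blast
  have ab: "3 \<le> card ?A" "3 \<le> card ?B"
    using three[OF fin(1) _ A(2)[OF _ a]] three[OF fin(2) _ B(2)[OF _ b]] a b by blast+
  then show "6 \<le> card V" using n by simp
  assume "card V = 6"
  then have le: "card ?A \<le> 3" "card ?B \<le> 3" using ab n by simp_all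
  have dom: "contract E u v u x" if "x \<in> V - {v}" "x \<noteq> u" for x
  proof (cases "x \<in> ?A")
    case True
    then have "E u x"
      using that A(2) uA by (intro triangle_side_dominated[OF fin(1) le(1) assms(2,1)]) auto
    then show ?thesis using that by (simp add: contract_def)
  next
    case False
    then have "x \<in> ?B" using that cover by blast
    then have "E v x"
      using that B(2) vB by (intro triangle_side_dominated[OF fin(2) le(2) assms(2,1)]) auto
    then show ?thesis using that by (simp add: contract_def)
  qed
  have c: "card (V - {v}) = 5" using \<open>card V = 6\<close> assms(3,5) by simp
  have "2 ^ (card (V - {v}) - 1) + card (V - {v}) + 1
      \<le> card (connected_sets (contract E u v) (V - {v}))"
    by (rule card_connected_sets_dominating(2)[OF symp_contract[OF assms(1)] irreflp_contract,
          where c = u]) (use assms(3,4) uv c dom deg' in auto)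
  then show "22 \<le> card (connected_sets (contract E u v) (V - {v}))" unfolding c by simp
qed

lemma min_count_less_dominating:
  assumes "3 \<le> n" and "2 ^ (n - 1) + n \<le> N" and "4 \<le> n \<Longrightarrow> 2 ^ (n - 1) + n + 1 \<le> N"
  shows "min_count n \<le> N" and "6 \<le> n \<Longrightarrow> min_count n < N"
proof -
  have pow: "min_count n < 2 ^ (n - 1) + n + 1" if "6 \<le> n"
    using that
  proof (induction n rule: dec_induct)
    case base
    then show ?case by (simp add: min_count_small)
  next
    case (step m)
    have m: "m = Suc (m - 1)" using step.hyps by simp
    have "(2::nat) ^ 3 \<le> 2 ^ (m - 1)" using step.hyps by (intro power_increasing) auto
    moreover have "(2::nat) ^ m = 2 * 2 ^ (m - 1)" by (subst m) simp
    moreover have "m + 1 < 2 ^ (m - 1)"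
      using step.hyps(1)
    proof (induction m rule: dec_induct)
      case (step k)
      have "k = Suc (k - 1)" using step.hyps by simp
      then have "(2::nat) ^ k = 2 * 2 ^ (k - 1)" by (metis power_Suc)
      then show ?case using step by simp
    qed simp
    ultimately show ?case using step min_count_step[of "Suc m"] by simp
  qed
  then show "6 \<le> n \<Longrightarrow> min_count n < N" using assms(3) by fastforce
  then show "min_count n \<le> N"
  proof (cases "6 \<le> n")
    case False
    then have "n = 3 \<or> n = 4 \<or> n = 5" using assms(1) by auto
    then show ?thesis using assms by (auto simp: min_count_small)
  qed simp
qed

text \<open>
  Contraction decreases the number of vertices and deletion the number of edges, whence the
  lexicographic measure. Equality can occur only when a bridge is contracted, and then the two sides
  of the bridge are tadpoles.
\<close>

theorem min_count_le_card_connected_sets: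
  assumes "finite V" "symp E" "irreflp E" "connected_on E V"
    and "\<And>x. x \<in> V \<Longrightarrow> two_nbrs E V x"
  shows "min_count (card V) \<le> card (connected_sets E V) \<and>
    (6 \<le> card V \<longrightarrow> card (connected_sets E V) = min_count (card V) \<longrightarrow> joined_tadpoles E V)"
  using assms
proof (induction "(V, E)" arbitrary: V E
    rule: wf_induct_rule[OF wf_measures[of "[\<lambda>(V, E). card V, \<lambda>(V, E). card {(x, y) \<in> V \<times> V. E x y}]"]])
  case (1 V E)
  note fin = 1(2) and symp = 1(3) and irrefl = 1(4) and conn = 1(5) and deg = 1(6)
  note sym = sympD[OF symp] and irr = irreflpD[OF irrefl]
  let ?N = "card (connected_sets E V)" and ?n = "card V"
  consider (contract) u v where "u \<in> V" "v \<in> V" "E u v" "\<forall>w\<in>V. \<not> (E u w \<and> E v w)"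
    | (delete) u v w where "u \<in> V" "v \<in> V" "E u v" "w \<in> V" "E u w" "E v w"
        "two_nbrs E (V - {v}) u" "two_nbrs E (V - {u}) v"
    | (dominating) "\<forall>u\<in>V. \<forall>v\<in>V. E u v \<longrightarrow> (\<exists>w\<in>V. E u w \<and> E v w)"
        "\<forall>u\<in>V. \<forall>v\<in>V. E u v \<longrightarrow> \<not> (two_nbrs E (V - {v}) u \<and> two_nbrs E (V - {u}) v)"
    by blast
  then show ?case
  proof cases
    case contract
    have uv: "u \<noteq> v" using contract(3) irr by metis
    have no_triangle: "\<And>w. w \<in> V \<Longrightarrow> \<not> (E u w \<and> E v w)" using contract(4) by blast
    let ?E = "contract E u v" and ?V = "V - {v}"
    let ?A = "component E (V - {v}) u" and ?B = "component E (V - {u}) v"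
    let ?R = "card (rooted_sets E ?A u) + card (rooted_sets E ?B v)"
    have cV: "card ?V = ?n - 1" using contract(2) fin by simp
    have deg': "two_nbrs ?E ?V x" if "x \<in> ?V" for x
      using two_nbrs_contract[OF symp irrefl contract(1-3) no_triangle deg that] .
    have "?n > 0" using fin contract(1) by (metis card_gt_0_iff empty_iff)
    then have IH: "min_count (?n - 1) \<le> card (connected_sets ?E ?V)"
      using 1(1)[of ?V ?E] fin symp_contract[OF symp, of u v] irreflp_contract[of E u v]
        connected_on_contract[OF conn contract(1,2) uv] deg' by (auto simp: cV)
    have N: "card (connected_sets ?E ?V) + ?R \<le> ?N"
      using card_connected_sets_contract[OF symp fin contract(3,1,2) uv component_subset component_subset]
      by (simp add: add.assoc)
    show ?thesis
    proof (cases "?A \<inter> ?B = {}")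
      case True
      note six = card_connected_sets_two_triangles[OF symp irrefl fin contract(1-3) conn deg deg' True]
      note bridge = card_rooted_sets_bridge[OF symp irrefl fin contract(1-3) conn deg True]
      \<comment> \<open>the induction hypothesis would only give \<open>21 + 8\<close> instead of \<open>30\<close> for six vertices\<close>
      have le: "min_count ?n \<le> card (connected_sets ?E ?V) + (?n + 2)"
      proof (cases "?n = 6")
        case True
        then show ?thesis using six(2) by (simp add: min_count_small)
      next
        case False
        then show ?thesis using IH min_count_step[of ?n] six(1) by simp
      qed
      have "?R = ?n + 2" if "?N = min_count ?n" using that le N bridge(1) by linarith
      then show ?thesis using le N bridge by auto
    next
      case False
      have R: "2 * ?n - 2 \<le> ?R"
        using card_rooted_sets_cycle[OF symp irrefl fin contract(1-3) conn no_triangle False] .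
      have n: "4 \<le> ?n"
      proof -
        obtain y where y: "y \<in> V" "y \<noteq> v" "E u y"
          using deg[OF contract(1)] by (auto simp: two_nbrs_def)
        obtain z where z: "z \<in> V" "z \<noteq> u" "E v z"
          using deg[OF contract(2)] by (auto simp: two_nbrs_def)
        have "y \<noteq> z" "y \<noteq> u" "z \<noteq> v" using y z no_triangle irr by metis+
        then have "card {u, v, y, z} = 4" using y z uv by auto
        then show ?thesis
          using card_mono[OF fin, of "{u, v, y, z}"] contract(1,2) y z by simp
      qed
      have step: "min_count ?n \<le> min_count (?n - 1) + (2 * ?n - 2)
          \<and> (6 \<le> ?n \<longrightarrow> min_count ?n < min_count (?n - 1) + (2 * ?n - 2))"
      proof (cases "7 \<le> ?n")
        case True
        then show ?thesis using min_count_step[of ?n] by linarith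
      next
        case False
        then have "?n = 4 \<or> ?n = 5 \<or> ?n = 6" using n by auto
        then show ?thesis by (auto simp: min_count_small)
      qed
      then show ?thesis using IH N R by linarith
    qed
  next
    case delete
    have uv: "u \<noteq> v" "u \<noteq> w" "v \<noteq> w" using delete irr by metis+
    define E' where "E' x y \<longleftrightarrow> E x y \<and> {x, y} \<noteq> {u, v}" for x y
    have symp': "symp E'" using sym by (auto intro!: sympI simp: E'_def insert_commute)
    have irr': "irreflp E'" using irr by (auto intro!: irreflpI simp: E'_def)
    have conn': "connected_on E' V"
    proof (rule connected_onI)
      show "V \<noteq> {}" using delete by blast
      fix P assume P: "P \<subseteq> V" "P \<noteq> V" "P \<noteq> {}"
      then obtain x y where xy: "x \<in> P" "y \<in> V" "y \<notin> P" "E x y"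
        using connected_onE[OF conn] by metis
      have tri: "E' u w" "E' w u" "E' v w" "E' w v"
        using delete uv sym by (auto simp: E'_def doubleton_eq_iff)
      \<comment> \<open>a cut crossed by the deleted edge is also crossed by one of the other two edges of its triangle\<close>
      show "\<exists>x\<in>P. \<exists>y\<in>V - P. E' x y"
      proof (cases "{x, y} = {u, v}")
        case False
        then show ?thesis using xy by (auto simp: E'_def)
      next
        case True
        then have "x = u \<and> y = v \<or> x = v \<and> y = u" by (auto simp: doubleton_eq_iff)
        then show ?thesis using xy tri delete(4) by (cases "w \<in> P") blast+
      qed
    qed
    have deg': "two_nbrs E' V x" if "x \<in> V" for x
    proof -
      have "two_nbrs E' V u"
        using delete(7) uv by (auto simp: two_nbrs_def E'_def doubleton_eq_iff)
      moreover have "two_nbrs E' V v"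
        using delete(8) uv by (auto simp: two_nbrs_def E'_def doubleton_eq_iff)
      moreover have "two_nbrs E' V x" if "x \<noteq> u" "x \<noteq> v"
        using deg[OF \<open>x \<in> V\<close>] that by (auto simp: two_nbrs_def E'_def doubleton_eq_iff)
      ultimately show ?thesis by blast
    qed
    have "{(x, y) \<in> V \<times> V. E' x y} \<subset> {(x, y) \<in> V \<times> V. E x y}"
      using delete(1-3) by (auto simp: E'_def)
    then have "card {(x, y) \<in> V \<times> V. E' x y} < card {(x, y) \<in> V \<times> V. E x y}"
      using fin by (intro psubset_card_mono) (auto intro: finite_subset[of _ "V \<times> V"])
    then have IH: "min_count ?n \<le> card (connected_sets E' V)"
      using 1(1)[of V E'] fin symp' irr' conn' deg' by auto
    have "connected_sets E' V \<subseteq> connected_sets E V"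
      by (auto simp: connected_sets_def E'_def elim: connected_on_mono)
    moreover have "{u, v} \<in> connected_sets E V"
      using delete connected_on_pair[OF symp] by (simp add: connected_sets_def)
    moreover have "\<not> connected_on E' {u, v}"
    proof
      assume "connected_on E' {u, v}"
      then obtain x y where "x \<in> {u}" "y \<in> {u, v}" "y \<notin> {u}" "E' x y"
        using uv connected_onE[of E' "{u, v}" "{u}"] by blast
      then show False by (auto simp: E'_def)
    qed
    then have "{u, v} \<notin> connected_sets E' V" by (simp add: connected_sets_def)
    ultimately have "connected_sets E' V \<subset> connected_sets E V" by blast
    then have "card (connected_sets E' V) < ?N"
      by (rule psubset_card_mono[OF finite_connected_sets[OF fin]])
    then show ?thesis using IH by simp
  next
    case dominating
    \<comment> \<open>a vertex of degree at least three if there is one, and any vertex otherwise (then \<open>G\<close> is a triangle)\<close>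
    obtain c where c: "c \<in> V" and low: "\<And>x. x \<in> V \<Longrightarrow> E c x \<Longrightarrow> \<not> two_nbrs E (V - {c}) x"
    proof (cases "\<exists>u\<in>V. \<exists>v\<in>V. E u v \<and> two_nbrs E (V - {v}) u")
      case True
      then obtain u v where uv: "u \<in> V" "v \<in> V" "E u v" "two_nbrs E (V - {v}) u" by blast
      have "two_nbrs E (V - {x}) u" for x
      proof -
        obtain y z where "y \<in> V - {v}" "z \<in> V - {v}" "y \<noteq> z" "E u y" "E u z"
          using uv(4) unfolding two_nbrs_def by blast
        then show ?thesis using uv(2,3) unfolding two_nbrs_def by (cases "x = y"; cases "x = z") blast+
      qed
      then show ?thesis using that[of u] uv dominating(2) by blast
    next
      case False
      then show ?thesis using that conn connected_on_nonempty sym by blast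
    qed
    \<comment> \<open>a neighbour \<open>s\<close> of \<open>c\<close> has at most one neighbour besides \<open>c\<close>, namely the third vertex of a triangle on the edge \<open>cs\<close>; so no edge leads away from the neighbours of \<open>c\<close>\<close>
    have dom: "E c x" if "x \<in> V" "x \<noteq> c" for x
    proof (rule ccontr)
      assume "\<not> E c x"
      then have "{y \<in> V. y = c \<or> E c y} \<noteq> V" using that by blast
      then obtain s z where sz: "s \<in> {y \<in> V. y = c \<or> E c y}" "z \<in> V" "z \<notin> {y \<in> V. y = c \<or> E c y}" "E s z"
        using connected_onE[OF conn, of "{y \<in> V. y = c \<or> E c y}"] c by blast
      then have s: "s \<in> V" "E c s" "z \<noteq> c" "\<not> E c z" by auto
      obtain w where w: "w \<in> V" "E c w" "E s w" using dominating(1) c s by blast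
      then have "w \<noteq> c" "w \<noteq> z" using irr s by metis+
      then have "two_nbrs E (V - {c}) s" unfolding two_nbrs_def using w sz s by blast
      then show False using low s by blast
    qed
    have n: "3 \<le> ?n"
    proof -
      obtain y z where yz: "y \<in> V" "z \<in> V" "y \<noteq> z" "E c y" "E c z"
        using deg[OF c] unfolding two_nbrs_def by blast
      then have "y \<noteq> c" "z \<noteq> c" using irr by metis+
      then have "card {c, y, z} = 3" using yz by simp
      then show ?thesis using card_mono[OF fin, of "{c, y, z}"] c yz by simp
    qed
    note dc = card_connected_sets_dominating[OF symp irrefl fin n c dom deg]
    show ?thesis using min_count_less_dominating[OF n dc] by auto
  qed
qed

section \<open>The double tadpole as a path with two chords\<close>

text \<open>
  The edges of the double tadpole from a smaller to a larger number, when its vertices are numbered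
  from the tip of one triangle to the tip of the other: a path with a chord at each end.
\<close>

definition link :: "nat \<Rightarrow> nat \<Rightarrow> nat \<Rightarrow> bool" where
  "link n i j \<longleftrightarrow> j = Suc i \<or> i = 0 \<and> j = 2 \<or> i + 3 = n \<and> Suc j = n"

definition linear_tadpole :: "nat \<Rightarrow> nat \<Rightarrow> nat \<Rightarrow> bool" where
  "linear_tadpole n i j \<longleftrightarrow> i < n \<and> j < n \<and> (i < j \<and> link n i j \<or> j < i \<and> link n j i)"

lemma connected_linear_tadpole:
  assumes "0 < n"
  shows "connected_on (linear_tadpole n) {..<n}"
proof (rule connected_onI)
  show "{..<n} \<noteq> {}" using assms by auto
  fix P assume P: "P \<subseteq> {..<n}" "P \<noteq> {..<n}" "P \<noteq> {}"
  have "\<exists>i. Suc i < n \<and> (i \<in> P \<longleftrightarrow> Suc i \<notin> P)"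
  proof (rule ccontr)
    assume "\<not> ?thesis"
    then have step: "i \<in> P \<longleftrightarrow> Suc i \<in> P" if "Suc i < n" for i using that by blast
    have "i \<in> P \<longleftrightarrow> 0 \<in> P" if "i < n" for i
      using that by (induction i) (use step in auto)
    then show False using P by blast
  qed
  then obtain i where i: "Suc i < n" "i \<in> P \<longleftrightarrow> Suc i \<notin> P" by blast
  have "linear_tadpole n i (Suc i)" "linear_tadpole n (Suc i) i"
    using i by (auto simp: linear_tadpole_def link_def)
  then show "\<exists>x\<in>P. \<exists>y\<in>{..<n} - P. linear_tadpole n x y"
    using i by (cases "i \<in> P") (force simp: lessThan_iff)+
qed

lemma two_nbrs_linear_tadpole:
  assumes "6 \<le> n" "i < n"
  shows "two_nbrs (linear_tadpole n) {..<n} i"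
proof -
  have *: ?thesis if "y < n" "z < n" "y \<noteq> z" "linear_tadpole n i y" "linear_tadpole n i z" for y z
    using that unfolding two_nbrs_def by (intro bexI[of _ y] bexI[of _ z]) auto
  consider "i = 0" | "i = n - 1" | "0 < i" "i < n - 1" using assms by linarith
  then show ?thesis
  proof cases
    case 1
    then show ?thesis using assms by (intro *[of 1 2]) (auto simp: linear_tadpole_def link_def)
  next
    case 2
    then show ?thesis using assms
      by (intro *[of "n - 2" "n - 3"]) (auto simp: linear_tadpole_def link_def)
  next
    case 3
    then show ?thesis using assms
      by (intro *[of "i - 1" "i + 1"]) (auto simp: linear_tadpole_def link_def)
  qed
qed

text \<open>
  If \<open>k\<close> is missing between two elements of a connected set, some edge must jump over \<open>k\<close>. Only the
  two chords do so: over the second vertex, starting from the first one, and over the last but one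
  vertex, reaching the last one. This leaves the intervals and the intervals from one or both ends
  with the vertex below the chord removed, \<open>n(n + 1)/2 + 2(n - 2) + 1\<close> sets in total.
\<close>

lemma card_connected_sets_linear_tadpole_le:
  assumes "6 \<le> n"
  shows "card (connected_sets (linear_tadpole n) {..<n}) \<le> min_count n"
proof -
  let ?pairs = "Sigma {..<n} (\<lambda>j. {..j})"
  let ?I = "(\<lambda>(j, i). {i..j}) ` ?pairs"
  let ?L = "(\<lambda>j. {0..j} - {1}) ` {2..<n}"
  let ?R = "(\<lambda>i. {i..n - 1} - {n - 2}) ` {..<n - 2}"
  let ?B = "{{0..n - 1} - {1, n - 2}}"
  have "S \<in> ?I \<union> ?L \<union> ?R \<union> ?B" if S: "S \<in> connected_sets (linear_tadpole n) {..<n}" for S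
  proof -
    have sub: "S \<subseteq> {..<n}" and conn: "connected_on (linear_tadpole n) S"
      using S by (auto simp: connected_sets_def)
    have ne: "S \<noteq> {}" using conn by (rule connected_on_nonempty)
    have finS: "finite S" using sub by (rule finite_subset) simp
    define i where "i = Min S"
    define j where "j = Max S"
    have i: "i \<in> S" "\<And>x. x \<in> S \<Longrightarrow> i \<le> x" using finS ne by (auto simp: i_def)
    have j: "j \<in> S" "\<And>x. x \<in> S \<Longrightarrow> x \<le> j" using finS ne by (auto simp: j_def)
    have ij: "i \<le> j" "j < n" using i j sub by auto
    have gap: "k = 1 \<and> i = 0 \<or> k = n - 2 \<and> j = n - 1" if k: "i < k" "k < j" "k \<notin> S" for k
    proof -
      let ?P = "{x \<in> S. x < k}"
      have "i \<in> ?P" "j \<notin> ?P" using i(1) k by auto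
      then have "?P \<subseteq> S" "?P \<noteq> S" "?P \<noteq> {}" using j(1) by blast+
      then obtain x y where "x \<in> ?P" "y \<in> S" "y \<notin> ?P" "linear_tadpole n x y"
        by (rule connected_onE[OF conn])
      then have xy: "x \<in> S" "y \<in> S" "x < k" "\<not> y < k" "linear_tadpole n x y" by auto
      then have "y \<noteq> k" using k(3) by blast
      then have "k < y" using xy(4) by simp
      then have "link n x y" using xy by (auto simp: linear_tadpole_def)
      then have "x = 0 \<and> y = 2 \<or> x + 3 = n \<and> Suc y = n" using xy \<open>k < y\<close> by (auto simp: link_def)
      then show ?thesis using xy \<open>k < y\<close> i(2)[of x] j(2)[of y] ij by auto
    qed
    \<comment> \<open>the vertices missing from the interval are at most \<open>1\<close> and \<open>n - 2\<close>\<close>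
    have S_eq: "S = {i..j} - {k. i < k \<and> k < j \<and> k \<notin> S}"
      using i j by (auto simp: le_less)
    let ?p = "i < 1 \<and> 1 < j \<and> 1 \<notin> S" and ?q = "i < n - 2 \<and> n - 2 < j \<and> n - 2 \<notin> S"
    have K: "{k. i < k \<and> k < j \<and> k \<notin> S} = {k. k = 1 \<and> ?p \<or> k = n - 2 \<and> ?q}"
      using gap by auto
    consider "\<not> ?p" "\<not> ?q" | "?p" "\<not> ?q" | "\<not> ?p" "?q" | "?p" "?q" by blast
    then show ?thesis
    proof cases
      case 1
      then have "S = {i..j}" using S_eq K by auto
      then show ?thesis using ij by auto
    next
      case 2
      then have "S = {0..j} - {1}" using S_eq K by auto
      then show ?thesis using ij 2 by auto
    next
      case 3
      then have "j = n - 1" using ij by auto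
      then have "S = {i..n - 1} - {n - 2}" using S_eq K 3 by auto
      then show ?thesis using 3 by auto
    next
      case 4
      then have "j = n - 1" "i = 0" using ij by auto
      then have "S = {0..n - 1} - {1, n - 2}" using S_eq K 4 by auto
      then show ?thesis by auto
    qed
  qed
  then have "connected_sets (linear_tadpole n) {..<n} \<subseteq> ?I \<union> ?L \<union> ?R \<union> ?B" by blast
  then have "card (connected_sets (linear_tadpole n) {..<n}) \<le> card (?I \<union> ?L \<union> ?R \<union> ?B)"
    by (intro card_mono) auto
  also have "\<dots> \<le> card ?I + card ?L + card ?R + card ?B"
    by (meson add_le_mono1 card_Un_le le_trans)
  also have "\<dots> \<le> card ?pairs + (n - 2) + (n - 2) + 1"
    using card_image_le[of ?pairs "\<lambda>(j, i). {i..j}"]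
      card_image_le[of "{2..<n}" "\<lambda>j. {0..j} - {1}"]
      card_image_le[of "{..<n - 2}" "\<lambda>i. {i..n - 1} - {n - 2}"] by simp
  also have "card ?pairs = (\<Sum>j<n. Suc j)" by simp
  also have "(\<Sum>j<n. Suc j) = n * (n + 1) div 2"
    by (induction n) auto
  also have "n * (n + 1) div 2 + (n - 2) + (n - 2) + 1 = min_count n"
  proof -
    obtain m where m: "n = m + 6" using assms by (metis le_add_diff_inverse2)
    have "(m + 5) * (m + 12) = (m + 6) * (m + 7) + (2 * m + 9) * 2" by (simp add: algebra_simps)
    then have "(m + 5) * (m + 12) div 2 = (m + 6) * (m + 7) div 2 + (2 * m + 9)" by simp
    then show ?thesis by (simp add: min_count_def m ac_simps)
  qed
  finally show ?thesis .
qed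

text \<open>
  The path of one tadpole is traversed towards its root and that of the other one away from its
  root; the bridge is the step between the two.
\<close>

lemma joined_tadpoles_linear:
  assumes "symp E" "irreflp E" "finite V" "joined_tadpoles E V"
  obtains k where "bij_betw k {..<card V} V"
    and "\<And>i j. i < card V \<Longrightarrow> j < card V \<Longrightarrow> E (k i) (k j) \<longleftrightarrow> linear_tadpole (card V) i j"
proof -
  note sym = sympD[OF assms(1)]
  obtain A B u v where AB: "A \<union> B = V" "A \<inter> B = {}" "rooted_tadpole E u A" "rooted_tadpole E v B"
    and cross: "\<And>x y. x \<in> A \<Longrightarrow> y \<in> B \<Longrightarrow> E x y \<longleftrightarrow> x = u \<and> y = v"
    using assms(4) unfolding joined_tadpoles_def by blast
  define a where "a = card A"
  define b where "b = card B"
  obtain h where h: "3 \<le> a" "bij_betw h {..<a} A" "h 0 = u"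
    "\<And>i j. i < j \<Longrightarrow> j < a \<Longrightarrow> E (h i) (h j) \<longleftrightarrow> j = Suc i \<or> i + 3 = a \<and> Suc j = a"
    using AB(3) by (auto simp: rooted_tadpole_def a_def)
  obtain g where g: "3 \<le> b" "bij_betw g {..<b} B" "g 0 = v"
    "\<And>i j. i < j \<Longrightarrow> j < b \<Longrightarrow> E (g i) (g j) \<longleftrightarrow> j = Suc i \<or> i + 3 = b \<and> Suc j = b"
    using AB(4) by (auto simp: rooted_tadpole_def b_def)
  have "finite A" "finite B" using assms(3) AB(1) by auto
  then have n: "card V = a + b" using AB(1,2) by (auto simp: a_def b_def card_Un_disjoint[symmetric])
  define k where "k i = (if i < a then h (a - 1 - i) else g (i - a))" for i
  have hA: "h i \<in> A" if "i < a" for i using h(2) that by (auto simp: bij_betw_def)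
  have gB: "g i \<in> B" if "i < b" for i using g(2) that by (auto simp: bij_betw_def)
  have h0: "h i = u \<longleftrightarrow> i = 0" if "i < a" for i
    using h(1-3) that inj_onD[of h "{..<a}" i 0] by (auto simp: bij_betw_def)
  have g0: "g i = v \<longleftrightarrow> i = 0" if "i < b" for i
    using g(1-3) that inj_onD[of g "{..<b}" i 0] by (auto simp: bij_betw_def)
  have "k ` {..<a + b} = V"
  proof
    show "k ` {..<a + b} \<subseteq> V" using hA gB AB(1) by (auto simp: k_def)
    show "V \<subseteq> k ` {..<a + b}"
    proof
      fix x assume "x \<in> V"
      then consider "x \<in> A" | "x \<in> B" using AB(1) by blast
      then show "x \<in> k ` {..<a + b}"
      proof cases
        case 1
        then obtain i where "i < a" "x = h i" using h(2) by (auto simp: bij_betw_def)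
        then have "x = k (a - 1 - i)" "a - 1 - i < a + b" by (auto simp: k_def)
        then show ?thesis by blast
      next
        case 2
        then obtain i where "i < b" "x = g i" using g(2) by (auto simp: bij_betw_def)
        then have "x = k (i + a)" "i + a < a + b" by (auto simp: k_def)
        then show ?thesis by blast
      qed
    qed
  qed
  then have bij: "bij_betw k {..<card V} V"
    using n by (auto simp: bij_betw_def intro!: eq_card_imp_inj_on)
  have lt: "E (k i) (k j) \<longleftrightarrow> link (a + b) i j" if ij: "i < j" "j < a + b" for i j
  proof -
    consider "j < a" | "i < a" "a \<le> j" | "a \<le> i" by linarith
    then show ?thesis
    proof cases
      case 1
      have "E (k i) (k j) \<longleftrightarrow> E (h (a - 1 - j)) (h (a - 1 - i))"
        using 1 ij sym by (auto simp: k_def)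
      also have "\<dots> \<longleftrightarrow> a - 1 - i = Suc (a - 1 - j) \<or> a - 1 - j + 3 = a \<and> Suc (a - 1 - i) = a"
        using 1 ij by (intro h(4)) auto
      also have "\<dots> \<longleftrightarrow> link (a + b) i j" using 1 ij g(1) by (auto simp: link_def)
      finally show ?thesis .
    next
      case 2
      have "E (k i) (k j) \<longleftrightarrow> E (h (a - 1 - i)) (g (j - a))"
        using 2 ij by (simp add: k_def)
      also have "\<dots> \<longleftrightarrow> a - 1 - i = 0 \<and> j - a = 0"
        using 2 ij by (subst cross) (auto simp: hA gB h0 g0)
      also have "\<dots> \<longleftrightarrow> link (a + b) i j" using 2 ij h(1) g(1) by (auto simp: link_def)
      finally show ?thesis .
    next
      case 3
      have "E (k i) (k j) \<longleftrightarrow> E (g (i - a)) (g (j - a))"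
        using 3 ij by (simp add: k_def)
      also have "\<dots> \<longleftrightarrow> j - a = Suc (i - a) \<or> i - a + 3 = b \<and> Suc (j - a) = b"
        using 3 ij by (intro g(4)) auto
      also have "\<dots> \<longleftrightarrow> link (a + b) i j" using 3 ij h(1) by (auto simp: link_def)
      finally show ?thesis .
    qed
  qed
  have "E (k i) (k j) \<longleftrightarrow> linear_tadpole (card V) i j" if "i < card V" "j < card V" for i j
  proof (cases i j rule: linorder_cases)
    case less
    then show ?thesis using lt[of i j] that n by (auto simp: linear_tadpole_def)
  next
    case equal
    then show ?thesis using irreflpD[OF assms(2)] by (auto simp: linear_tadpole_def)
  next
    case greater
    have "E (k i) (k j) \<longleftrightarrow> E (k j) (k i)" using sym by blast
    then show ?thesis using greater lt[of j i] that n by (auto simp: linear_tadpole_def)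
  qed
  then show ?thesis using that bij by blast
qed

lemma connected_on_image:
  assumes "connected_on E S" "\<And>x y. x \<in> S \<Longrightarrow> y \<in> S \<Longrightarrow> E x y \<Longrightarrow> F (k x) (k y)"
  shows "connected_on F (k ` S)"
proof (rule connected_onI)
  show "k ` S \<noteq> {}" using connected_on_nonempty[OF assms(1)] by simp
  fix P assume P: "P \<subseteq> k ` S" "P \<noteq> k ` S" "P \<noteq> {}"
  let ?P = "{x \<in> S. k x \<in> P}"
  have "?P \<subseteq> S" "?P \<noteq> S" "?P \<noteq> {}" using P by auto
  then obtain x y where "x \<in> ?P" "y \<in> S" "y \<notin> ?P" "E x y"
    by (rule connected_onE[OF assms(1)])
  then show "\<exists>x\<in>P. \<exists>y\<in>k ` S - P. F x y" using assms(2) by blast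
qed

lemma card_connected_sets_le:
  assumes "bij_betw k V W" "finite V"
    and "\<And>x y. x \<in> V \<Longrightarrow> y \<in> V \<Longrightarrow> E x y \<Longrightarrow> F (k x) (k y)"
  shows "card (connected_sets E V) \<le> card (connected_sets F W)"
proof (rule card_inj_on_le[where f = "image k"])
  show "inj_on (image k) (connected_sets E V)"
    using assms(1) by (auto simp: bij_betw_def connected_sets_def inj_on_image_eq_iff intro!: inj_onI)
  show "image k ` connected_sets E V \<subseteq> connected_sets F W"
    using assms(1,3) by (fastforce simp: bij_betw_def connected_sets_def intro: connected_on_image)
  show "finite (connected_sets F W)"
    using assms(1,2) by (auto simp: bij_betw_def intro: finite_connected_sets)
qed

lemma card_connected_sets_bij:
  assumes "bij_betw k V W" "finite V"
    and "\<And>x y. x \<in> V \<Longrightarrow> y \<in> V \<Longrightarrow> E x y \<longleftrightarrow> F (k x) (k y)"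
  shows "card (connected_sets E V) = card (connected_sets F W)"
proof (rule antisym)
  show "card (connected_sets E V) \<le> card (connected_sets F W)"
    using card_connected_sets_le[OF assms(1,2)] assms(3) by blast
  let ?k = "inv_into V k"
  have "bij_betw ?k W V" using assms(1) by (rule bij_betw_inv_into)
  moreover have "finite W" using assms(1,2) bij_betw_finite by blast
  moreover have "E (?k x) (?k y)" if "x \<in> W" "y \<in> W" "F x y" for x y
    using that assms(1,3) by (auto simp: bij_betw_def inv_into_into f_inv_into_f)
  ultimately show "card (connected_sets F W) \<le> card (connected_sets E V)"
    by (rule card_connected_sets_le)
qed

section \<open>From adjacency relations to digraphs\<close>

definition adj :: "('a, 'b) pre_digraph \<Rightarrow> 'a \<Rightarrow> 'a \<Rightarrow> bool" where
  "adj G x y \<longleftrightarrow> (x, y) \<in> arcs_ends G"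

lemma adj_iff: "adj G x y \<longleftrightarrow> (\<exists>e\<in>arcs G. tail G e = x \<and> head G e = y)"
  by (auto simp: adj_def arcs_ends_conv image_iff)

lemma symp_adj: "symmetric G \<Longrightarrow> symp (adj G)"
  by (auto simp: adj_def intro!: sympI dest: arcs_ends_symmetric)

lemma (in loopfree_digraph) irreflp_adj: "irreflp (adj G)"
  by (auto simp: adj_def intro!: irreflpI dest: adj_not_same)

text \<open>
  A walk that leaves a part crosses its cut; conversely, no edge leaves the set of vertices
  reachable from a given one.
\<close>

lemma connected_iff_connected_on:
  assumes "wf_digraph G" "symmetric G"
  shows "Digraph_Component.connected G \<longleftrightarrow> connected_on (adj G) (verts G)"
proof -
  interpret wf_digraph G by fact
  have conn: "Digraph_Component.connected G \<longleftrightarrow>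
      verts G \<noteq> {} \<and> (\<forall>u\<in>verts G. \<forall>v\<in>verts G. u \<rightarrow>\<^sup>*\<^bsub>G\<^esub> v)"
    by (simp add: Digraph_Component.connected_def strongly_connected_def
        reachable_mk_symmetric_eq[OF assms(2)])
  show ?thesis
  proof
    assume reach: "Digraph_Component.connected G"
    show "connected_on (adj G) (verts G)"
    proof (rule connected_onI)
      show "verts G \<noteq> {}" using reach conn by blast
      fix P assume P: "P \<subseteq> verts G" "P \<noteq> verts G" "P \<noteq> {}"
      then obtain u v where uv: "u \<in> P" "v \<in> verts G" "v \<notin> P" by blast
      show "\<exists>x\<in>P. \<exists>y\<in>verts G - P. adj G x y"
      proof (rule ccontr)
        assume none: "\<not> ?thesis"
        have "u \<rightarrow>\<^sup>*\<^bsub>G\<^esub> v" using reach conn uv P by blast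
        then have "v \<in> P"
        proof (induction rule: reachable_induct)
          case (step x y)
          then show ?case using none adj_in_verts(2) by (auto simp: adj_def)
        qed (use uv in simp)
        then show False using uv by blast
      qed
    qed
  next
    assume cut: "connected_on (adj G) (verts G)"
    have "u \<rightarrow>\<^sup>*\<^bsub>G\<^esub> v" if uv: "u \<in> verts G" "v \<in> verts G" for u v
    proof (rule ccontr)
      assume "\<not> u \<rightarrow>\<^sup>*\<^bsub>G\<^esub> v"
      then have "{w \<in> verts G. u \<rightarrow>\<^sup>*\<^bsub>G\<^esub> w} \<subseteq> verts G" "{w \<in> verts G. u \<rightarrow>\<^sup>*\<^bsub>G\<^esub> w} \<noteq> verts G"
        "{w \<in> verts G. u \<rightarrow>\<^sup>*\<^bsub>G\<^esub> w} \<noteq> {}" using uv by auto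
      then obtain x y where "x \<in> {w \<in> verts G. u \<rightarrow>\<^sup>*\<^bsub>G\<^esub> w}" "y \<in> verts G"
        "y \<notin> {w \<in> verts G. u \<rightarrow>\<^sup>*\<^bsub>G\<^esub> w}" "adj G x y"
        by (rule connected_onE[OF cut])
      then show False using reachable_adj_trans by (auto simp: adj_def)
    qed
    then show "Digraph_Component.connected G" using conn connected_on_nonempty[OF cut] by blast
  qed
qed

lemma num_connected_induced_eq:
  assumes "graph G"
  shows "num_connected_induced G = card (connected_sets (adj G) (verts G))"
proof -
  interpret graph G by fact
  have "Digraph_Component.connected (G \<restriction> S) \<longleftrightarrow> connected_on (adj G) S" for S
  proof -
    have adj: "adj (G \<restriction> S) x y \<longleftrightarrow> x \<in> S \<and> y \<in> S \<and> adj G x y" for x y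
      by (auto simp: adj_iff)
    have "symmetric (G \<restriction> S)"
      using symp_adj[OF sym_arcs] adj unfolding symmetric_def sym_def
      by (metis adj_def sympD)
    then have "Digraph_Component.connected (G \<restriction> S) \<longleftrightarrow> connected_on (adj (G \<restriction> S)) S"
      using connected_iff_connected_on[OF wellformed_induce_subgraph, of S] by simp
    also have "\<dots> \<longleftrightarrow> connected_on (adj G) S"
      by (auto simp: adj elim!: connected_on_mono)
    finally show ?thesis .
  qed
  then show ?thesis
    by (auto simp: num_connected_induced_def connected_sets_def dest: connected_on_nonempty
        intro!: arg_cong[where f = card])
qed

text \<open>
  A connected graph with two vertices has no isolated vertices, so degree different from one means
  at least two arcs, and these have different heads because there are no parallel arcs.
\<close>

lemma not_pendant_iff_two_nbrs:
  assumes "graph G" "connected_on (adj G) (verts G)" "2 \<le> card (verts G)" "x \<in> verts G"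
  shows "\<not> pendant G x \<longleftrightarrow> two_nbrs (adj G) (verts G) x"
proof -
  interpret graph G by fact
  have "verts G \<noteq> {x}" using assms(3) by auto
  then obtain y where "y \<in> verts G" "adj G x y"
    using connected_onE[OF assms(2), of "{x}"] assms(4) by blast
  then obtain e where e: "e \<in> out_arcs G x" by (auto simp: adj_iff)
  show ?thesis
  proof
    assume "\<not> pendant G x"
    then have "out_arcs G x \<noteq> {e}" using assms(4) by (auto simp: pendant_def out_degree_def)
    then obtain e' where e': "e' \<in> out_arcs G x" "e' \<noteq> e" using e by blast
    have "head G e \<noteq> head G e'"
      using no_multi_arcs[of e e'] e e' by (auto simp: arc_to_ends_def)
    moreover have "adj G x (head G e)" "adj G x (head G e')" "head G e \<in> verts G" "head G e' \<in> verts G"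
      using e e' by (auto simp: adj_iff)
    ultimately show "two_nbrs (adj G) (verts G) x" unfolding two_nbrs_def by blast
  next
    assume "two_nbrs (adj G) (verts G) x"
    then obtain e1 e2 where "e1 \<in> out_arcs G x" "e2 \<in> out_arcs G x" "e1 \<noteq> e2"
      by (auto simp: two_nbrs_def adj_iff)
    then have "out_degree G x \<noteq> 1"
      unfolding out_degree_def by (metis One_nat_def card_1_singletonE singletonD)
    then show "\<not> pendant G x" by (simp add: pendant_def)
  qed
qed

text \<open>
  Without parallel arcs an arc is determined by its ends, so a bijection of the vertices already
  fixes the map of the arcs.
\<close>

lemma digraph_iso_of_bij:
  fixes H :: "('c, 'c \<times> 'c) pre_digraph"
  assumes "graph G" "graph H" "tail H = fst" "head H = snd"
    and bij: "bij_betw k (verts G) (verts H)"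
    and k: "\<And>x y. x \<in> verts G \<Longrightarrow> y \<in> verts G \<Longrightarrow> adj G x y \<longleftrightarrow> adj H (k x) (k y)"
  shows "digraph_iso G H"
proof -
  interpret G: graph G by fact
  interpret H: graph H by fact
  define f where "f = \<lparr>iso_verts = k, iso_arcs = (\<lambda>e. (k (tail G e), k (head G e))),
    iso_head = snd, iso_tail = fst :: 'c \<times> 'c \<Rightarrow> 'c\<rparr>"
  have inj: "inj_on k (verts G)" and im: "k ` verts G = verts H" using bij by (auto simp: bij_betw_def)
  have H: "(a, b) \<in> arcs H \<longleftrightarrow> adj H a b" for a b
    using assms(3,4) by (force simp: adj_iff)
  have "inj_on (iso_arcs f) (arcs G)"
  proof (rule inj_onI)
    fix e e' assume e: "e \<in> arcs G" "e' \<in> arcs G" "iso_arcs f e = iso_arcs f e'"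
    then have "tail G e = tail G e'" "head G e = head G e'"
      using inj by (auto simp: f_def inj_on_eq_iff)
    then show "e = e'" using e G.no_multi_arcs by (auto simp: arc_to_ends_def)
  qed
  then have "G.digraph_isomorphism f"
    using inj G.wf_digraph by (simp add: G.digraph_isomorphism_def f_def)
  moreover have "iso_arcs f ` arcs G = arcs H"
  proof
    show "iso_arcs f ` arcs G \<subseteq> arcs H"
    proof
      fix p assume "p \<in> iso_arcs f ` arcs G"
      then obtain e where e: "e \<in> arcs G" "p = (k (tail G e), k (head G e))" by (auto simp: f_def)
      then have "adj G (tail G e) (head G e)" by (auto simp: adj_iff)
      then show "p \<in> arcs H" using e k H by simp
    qed
    show "arcs H \<subseteq> iso_arcs f ` arcs G"
    proof
      fix p assume p: "p \<in> arcs H"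
      then have "fst p \<in> verts H" "snd p \<in> verts H"
        using H.tail_in_verts[OF p] H.head_in_verts[OF p] assms(3,4) by auto
      then obtain x y where xy: "x \<in> verts G" "y \<in> verts G" "p = (k x, k y)"
        using im by (metis image_iff prod.collapse)
      then have "adj G x y" using p H k by simp
      then obtain e where "e \<in> arcs G" "tail G e = x" "head G e = y"
        by (auto simp: adj_iff)
      then show "p \<in> iso_arcs f ` arcs G" using xy by (auto simp: f_def intro!: image_eqI[of _ _ e])
    qed
  qed
  then have "H = app_iso f G"
    using im assms(3,4) by (intro pre_digraph.equality) (auto simp: f_def)
  ultimately show ?thesis unfolding digraph_iso_def by blast
qed

lemma num_connected_induced_iso:
  assumes "graph G" "graph H" "digraph_iso G H"
  shows "num_connected_induced G = num_connected_induced H"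
proof -
  interpret G: graph G by fact
  obtain f where f: "G.digraph_isomorphism f" "H = app_iso f G"
    using assms(3) by (auto simp: digraph_iso_def)
  have inj: "inj_on (iso_verts f) (verts G)" using f(1) by (simp add: G.digraph_isomorphism_def)
  have ends: "tail H (iso_arcs f e) = iso_verts f (tail G e)"
    "head H (iso_arcs f e) = iso_verts f (head G e)" if "e \<in> arcs G" for e
    using f that by (auto simp: G.digraph_isomorphism_def)
  have arcs: "arcs H = iso_arcs f ` arcs G" using f(2) by simp
  have "bij_betw (iso_verts f) (verts G) (verts H)" using inj f(2) by (simp add: bij_betw_def)
  moreover have "adj G x y \<longleftrightarrow> adj H (iso_verts f x) (iso_verts f y)"
    if "x \<in> verts G" "y \<in> verts G" for x y
  proof
    assume "adj G x y"
    then show "adj H (iso_verts f x) (iso_verts f y)"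
      using ends arcs by (force simp: adj_iff)
  next
    assume "adj H (iso_verts f x) (iso_verts f y)"
    then obtain e where "e \<in> arcs G" "iso_verts f (tail G e) = iso_verts f x"
      "iso_verts f (head G e) = iso_verts f y"
      using ends arcs by (auto simp: adj_iff)
    then show "adj G x y" using inj that by (auto simp: adj_iff inj_on_eq_iff)
  qed
  ultimately have "card (connected_sets (adj G) (verts G)) = card (connected_sets (adj H) (verts H))"
    using G.finite_verts by (intro card_connected_sets_bij)
  then show ?thesis by (simp add: num_connected_induced_eq[OF assms(1)] num_connected_induced_eq[OF assms(2)])
qed

section \<open>The labelling of the double tadpole\<close>

text \<open>
  The vertex of \<^const>\<open>double_tadpole\<close> at each position of the path with two chords: the path vertices
  are shifted by two because the tips \<open>n - 3\<close> and \<open>n - 4\<close> of the first triangle come before them.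
\<close>

definition position_label :: "nat \<Rightarrow> nat \<Rightarrow> nat" where
  "position_label n i = (if i = 0 then n - 3 else if i = 1 then n - 4 else if n - 2 \<le> i then i else i - 2)"

lemma bij_position_label:
  assumes "6 \<le> n"
  shows "bij_betw (position_label n) {..<n} {..<n}"
proof -
  have "inj_on (position_label n) {..<n}"
    using assms by (auto simp: position_label_def inj_on_def split: if_splits)
  moreover have "position_label n ` {..<n} \<subseteq> {..<n}"
    using assms by (auto simp: position_label_def)
  ultimately show ?thesis by (simp add: bij_betw_def endo_inj_surj)
qed

lemma verts_double_tadpole: "6 \<le> n \<Longrightarrow> verts (double_tadpole n) = {..<n}"
  by (auto simp: double_tadpole_def path_graph_def triangle_graph_def graph_of_def
      Digraph_Component.union_def)

lemma ends_double_tadpole: "tail (double_tadpole n) = fst" "head (double_tadpole n) = snd"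
  by (simp_all add: double_tadpole_def path_graph_def triangle_graph_def graph_of_def
      Digraph_Component.union_def)

lemma arcs_double_tadpole:
  "arcs (double_tadpole n) =
    (let E = {(i, Suc i) | i. Suc i < n - 4} \<union> {(0, n - 4), (n - 4, n - 3), (n - 3, 0)}
       \<union> {(n - 5, n - 2), (n - 2, n - 1), (n - 1, n - 5)} in E \<union> E\<inverse>)"
  by (auto simp: double_tadpole_def path_graph_def triangle_graph_def graph_of_def
      Digraph_Component.union_def)

text \<open>
  The arcs from which \<^const>\<open>double_tadpole\<close> is built, one per edge and without truncated
  subtractions: the number of vertices is \<open>m + 6\<close>.
\<close>

definition tadpole_arc :: "nat \<Rightarrow> nat \<Rightarrow> nat \<Rightarrow> bool" where
  "tadpole_arc m x y \<longleftrightarrow> y = Suc x \<and> y < m + 2 \<or> x = 0 \<and> y = m + 2 \<or> x = m + 2 \<and> y = m + 3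
     \<or> x = m + 3 \<and> y = 0 \<or> x = m + 1 \<and> y = m + 4 \<or> x = m + 4 \<and> y = m + 5 \<or> x = m + 5 \<and> y = m + 1"

lemma adj_double_tadpole:
  "adj (double_tadpole (m + 6)) x y \<longleftrightarrow> tadpole_arc m x y \<or> tadpole_arc m y x"
proof -
  let ?E = "{(i, Suc i) | i. Suc i < m + 2} \<union> {(0, m + 2), (m + 2, m + 3), (m + 3, 0)}
    \<union> {(m + 1, m + 4), (m + 4, m + 5), (m + 5, m + 1)}"
  have E: "(a, b) \<in> ?E \<longleftrightarrow> tadpole_arc m a b" for a b
    unfolding tadpole_arc_def by blast
  have "m + 6 - 4 = m + 2" "m + 6 - 3 = m + 3" "m + 6 - 5 = m + 1" "m + 6 - 2 = m + 4" "m + 6 - 1 = m + 5"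
    by simp_all
  then have arcs: "arcs (double_tadpole (m + 6)) = ?E \<union> ?E\<inverse>"
    unfolding arcs_double_tadpole Let_def by (simp only:)
  have "adj (double_tadpole (m + 6)) x y \<longleftrightarrow> (x, y) \<in> arcs (double_tadpole (m + 6))"
    by (auto simp: adj_iff ends_double_tadpole intro: bexI[of _ "(x, y)"])
  then show ?thesis unfolding arcs Un_iff[of _ ?E] converse_iff E .
qed

lemma graph_double_tadpole:
  assumes "6 \<le> n"
  shows "graph (double_tadpole n)"
proof -
  let ?D = "double_tadpole n"
  have arc: "fst e < n \<and> snd e < n \<and> fst e \<noteq> snd e" if "e \<in> arcs ?D" for e
    using that assms by (auto simp: arcs_double_tadpole Let_def)
  obtain E where "arcs ?D = E \<union> E\<inverse>" by (simp only: arcs_double_tadpole Let_def)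
  then have sym: "(y, x) \<in> arcs ?D" if "(x, y) \<in> arcs ?D" for x y
    using that by blast
  show ?thesis
  proof unfold_locales
    show "symmetric ?D"
      using sym by (simp add: symmetric_def sym_def arcs_ends_conv ends_double_tadpole)
    show "finite (arcs ?D)"
      using arc by (intro finite_subset[of "arcs ?D" "{..<n} \<times> {..<n}"]) force+
  qed (use arc in \<open>auto simp: verts_double_tadpole[OF assms] ends_double_tadpole arc_to_ends_def prod_eq_iff\<close>)
qed

text \<open>
  The vertices at the positions \<open>i\<close> and \<open>j\<close> are \<open>a\<close> and \<open>b\<close>; with variables for the labels, each
  combination of cases is linear arithmetic.
\<close>

lemma link_iff_tadpole_arc:
  assumes "i < j"
    and i: "i = 0 \<and> a = m + 3 \<or> i = 1 \<and> a = m + 2 \<or> i = m + 4 \<and> a = m + 4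
      \<or> i = m + 5 \<and> a = m + 5 \<or> i = a + 2 \<and> a < m + 2"
    and j: "j = 0 \<and> b = m + 3 \<or> j = 1 \<and> b = m + 2 \<or> j = m + 4 \<and> b = m + 4
      \<or> j = m + 5 \<and> b = m + 5 \<or> j = b + 2 \<and> b < m + 2"
  shows "link (m + 6) i j \<longleftrightarrow> tadpole_arc m a b \<or> tadpole_arc m b a"
  using i j assms(1)
  by (elim disjE conjE; simp add: link_def tadpole_arc_def; linarith?)

lemma adj_double_tadpole_position:
  assumes n: "6 \<le> n" and "i < n" "j < n"
  shows "linear_tadpole n i j \<longleftrightarrow> adj (double_tadpole n) (position_label n i) (position_label n j)"
proof -
  interpret graph "double_tadpole n" by (rule graph_double_tadpole[OF n])
  note sym = sympD[OF symp_adj[OF sym_arcs]] and irr = irreflpD[OF irreflp_adj]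
  have lt: "link n i j \<longleftrightarrow> adj (double_tadpole n) (position_label n i) (position_label n j)"
    if "i < j" "j < n" for i j
  proof -
    obtain m where m: "n = m + 6" using n by (metis le_add_diff_inverse2)
    have pos: "k = 0 \<and> position_label n k = m + 3 \<or> k = 1 \<and> position_label n k = m + 2
        \<or> k = m + 4 \<and> position_label n k = m + 4 \<or> k = m + 5 \<and> position_label n k = m + 5
        \<or> k = position_label n k + 2 \<and> position_label n k < m + 2" if "k < n" for k
      using that by (auto simp: position_label_def m)
    have "i < n" using that by simp
    then show ?thesis
      using link_iff_tadpole_arc[OF \<open>i < j\<close> pos[OF \<open>i < n\<close>] pos[OF \<open>j < n\<close>]]
      by (simp only: m adj_double_tadpole)
  qed
  show ?thesis
  proof (cases i j rule: linorder_cases)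
    case less
    then show ?thesis using lt[of i j] assms by (auto simp: linear_tadpole_def)
  next
    case equal
    then show ?thesis using irr by (auto simp: linear_tadpole_def)
  next
    case greater
    then show ?thesis using lt[of j i] assms sym by (auto simp: linear_tadpole_def)
  qed
qed

lemma min_count_le_num_connected_induced:
  assumes "graph G" "Digraph_Component.connected G" "\<nexists>v. pendant G v" "6 \<le> card (verts G)"
  shows "min_count (card (verts G)) \<le> num_connected_induced G"
    and "num_connected_induced G = min_count (card (verts G)) \<Longrightarrow> joined_tadpoles (adj G) (verts G)"
proof -
  interpret graph G by fact
  have conn: "connected_on (adj G) (verts G)"
    using connected_iff_connected_on[OF wf_digraph sym_arcs] assms(2) by simp
  have "two_nbrs (adj G) (verts G) x" if "x \<in> verts G" for x
    using not_pendant_iff_two_nbrs[OF assms(1) conn _ that] assms(3,4) by simp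
  then have "min_count (card (verts G)) \<le> num_connected_induced G \<and>
      (num_connected_induced G = min_count (card (verts G)) \<longrightarrow> joined_tadpoles (adj G) (verts G))"
    using min_count_le_card_connected_sets[OF finite_verts symp_adj[OF sym_arcs] irreflp_adj conn]
      num_connected_induced_eq[OF assms(1)] assms(4) by simp
  then show "min_count (card (verts G)) \<le> num_connected_induced G"
    and "num_connected_induced G = min_count (card (verts G)) \<Longrightarrow> joined_tadpoles (adj G) (verts G)"
    by blast+
qed

lemma real_min_count:
  assumes "6 \<le> n"
  shows "real (min_count n) = (real n - 1) * (real n + 6) / 2"
proof -
  have "even ((n - 1) * (n + 6))" using assms by (cases "even n") auto
  then have "2 * min_count n = (n - 1) * (n + 6)" using assms by (simp add: min_count_def)
  then have "2 * real (min_count n) = real (n - 1) * real (n + 6)"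
    by (metis of_nat_mult of_nat_numeral)
  then show ?thesis using assms by (simp add: of_nat_diff)
qed

theorem theorem24:
  fixes n :: nat
  assumes "n > 5"
  shows "(graph (double_tadpole n)
      \<and> card (verts (double_tadpole n)) = n
      \<and> Digraph_Component.connected (double_tadpole n)
      \<and> (\<nexists>v. pendant (double_tadpole n) v))
    \<and> real (num_connected_induced (double_tadpole n)) = (real n - 1) * (real n + 6) / 2
    \<and> (\<forall>G :: ('a, 'b) pre_digraph.
        graph G \<and> card (verts G) = n \<and> Digraph_Component.connected G \<and> (\<nexists>v. pendant G v) \<longrightarrow>
          num_connected_induced G \<ge> num_connected_induced (double_tadpole n)
          \<and> (real (num_connected_induced G) = (real n - 1) * (real n + 6) / 2
              \<longleftrightarrow> digraph_iso G (double_tadpole n)))"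
proof -
  let ?D = "double_tadpole n"
  have n: "6 \<le> n" using assms by simp
  interpret D: graph ?D by (rule graph_double_tadpole[OF n])
  note label = bij_position_label[OF n] and verts = verts_double_tadpole[OF n]
  have label_image: "position_label n ` {..<n} = {..<n}" using label by (simp add: bij_betw_def)
  have position: "\<And>i j. i \<in> {..<n} \<Longrightarrow> j \<in> {..<n} \<Longrightarrow>
      linear_tadpole n i j \<longleftrightarrow> adj ?D (position_label n i) (position_label n j)"
    using adj_double_tadpole_position[OF n] by simp
  have "connected_on (adj ?D) (position_label n ` {..<n})"
    by (rule connected_on_image[OF connected_linear_tadpole]) (use n position in auto)
  then have conn: "connected_on (adj ?D) (verts ?D)" by (simp only: label_image verts)
  have "two_nbrs (adj ?D) (verts ?D) x" if x: "x \<in> verts ?D" for x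
  proof -
    have "x \<in> position_label n ` {..<n}" using x by (simp only: label_image verts)
    then obtain i where i: "i < n" "x = position_label n i" by auto
    obtain y z where yz: "y < n" "z < n" "y \<noteq> z" "linear_tadpole n i y" "linear_tadpole n i z"
      using two_nbrs_linear_tadpole[OF n i(1)] by (auto simp: two_nbrs_def)
    then have "position_label n y \<noteq> position_label n z"
      using label by (auto simp: bij_betw_def inj_on_eq_iff)
    moreover have "position_label n y \<in> verts ?D" "position_label n z \<in> verts ?D"
      using yz bij_betwE[OF label] verts by simp_all
    moreover have "adj ?D x (position_label n y)" "adj ?D x (position_label n z)"
      using yz i position by simp_all
    ultimately show ?thesis unfolding two_nbrs_def by blast
  qed
  then have no_pendant: "\<nexists>v. pendant ?D v"
    using not_pendant_iff_two_nbrs[OF D.graph_axioms conn] n verts by (auto simp: pendant_def)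
  have connected: "Digraph_Component.connected ?D"
    using connected_iff_connected_on[OF D.wf_digraph D.sym_arcs] conn by simp
  have "card (connected_sets (linear_tadpole n) {..<n}) = card (connected_sets (adj ?D) {..<n})"
    using position by (intro card_connected_sets_bij[OF label]) auto
  then have "num_connected_induced ?D \<le> min_count n"
    using card_connected_sets_linear_tadpole_le[OF n] num_connected_induced_eq[OF D.graph_axioms] verts
    by simp
  moreover have "min_count n \<le> num_connected_induced ?D"
    using min_count_le_num_connected_induced(1)[OF D.graph_axioms connected no_pendant] verts n by simp
  ultimately have count: "num_connected_induced ?D = min_count n" by simp
  have iso: "digraph_iso G ?D"
    if G: "graph G" "card (verts G) = n" "joined_tadpoles (adj G) (verts G)"
    for G :: "('a, 'b) pre_digraph"
  proof -
    interpret G: graph G by fact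
    obtain k where k: "bij_betw k {..<n} (verts G)"
      and adj: "\<And>i j. i < n \<Longrightarrow> j < n \<Longrightarrow> adj G (k i) (k j) \<longleftrightarrow> linear_tadpole n i j"
      using joined_tadpoles_linear[OF symp_adj[OF G.sym_arcs] G.irreflp_adj G.finite_verts G(3)]
      unfolding G(2) by blast
    let ?k = "inv_into {..<n} k"
    have inv: "?k x < n" "k (?k x) = x" if "x \<in> verts G" for x
      using that k inv_into_into[of x k "{..<n}"] by (auto simp: bij_betw_def f_inv_into_f)
    have "bij_betw (position_label n \<circ> ?k) (verts G) (verts ?D)"
      using bij_betw_trans[OF bij_betw_inv_into[OF k] label] verts by simp
    moreover have "adj G x y \<longleftrightarrow> adj ?D ((position_label n \<circ> ?k) x) ((position_label n \<circ> ?k) y)"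
      if "x \<in> verts G" "y \<in> verts G" for x y
      using adj[of "?k x" "?k y"] position[of "?k x" "?k y"] inv that by simp
    ultimately show ?thesis
      by (rule digraph_iso_of_bij[OF G(1) D.graph_axioms ends_double_tadpole])
  qed
  have extremal: "num_connected_induced ?D \<le> num_connected_induced G
      \<and> (num_connected_induced G = min_count n \<longleftrightarrow> digraph_iso G ?D)"
    if G: "graph G" "card (verts G) = n" "Digraph_Component.connected G" "\<nexists>v. pendant G v"
    for G :: "('a, 'b) pre_digraph"
  proof -
    have "6 \<le> card (verts G)" using n G(2) by simp
    note bound = min_count_le_num_connected_induced[OF G(1,3,4) this, unfolded G(2)]
    show ?thesis
      using bound iso[OF G(1,2)] num_connected_induced_iso[OF G(1) D.graph_axioms] count by metis
  qed
  have value_iff: "real N = (real n - 1) * (real n + 6) / 2 \<longleftrightarrow> N = min_count n" for N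
    unfolding real_min_count[OF n, symmetric] by (rule of_nat_eq_iff)
  have "card (verts ?D) = n" using verts by simp
  then show ?thesis
    unfolding value_iff using D.graph_axioms connected no_pendant count extremal by blast
qed

end
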